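(* Let $A$ be a unital $C^*$-algebra and let $a\in A_+^{-1}$. The following are equivalent: (i) $a$ is a central element of $A$; (ii) $\|axa^{-1}\|=\|x\|$ for every $x\in A_+^{-1}$; (iii) $\|a^2x\|=\|axa\|$ for every $x\in A_+^{-1}$; (iv) $\|ax\|=\|ax\|_S$ for every $x\in A_+^{-1}$; (v) $\|a^2x\|=\|a^2x\|_S$ for every $x\in A_+^{-1}$.
   Context: For a unital $C^*$-algebra $A$, $A_+^{-1}$ denotes the positive definite cone of $A$, i.e. the set of all positive invertible elements of $A$. For $a\in A$ with spectrum $\sigma(a)$, $\|a\|_S=\sup\{|t|\colon t\in\sigma(a)\}$ is the spectral seminorm. *)

theory Defs
  imports "HOL-Analysis.Analysis"
begin

class scaleC =
  fixes scaleC :: "complex \<Rightarrow> 'a \<Rightarrow> 'a"  (infixr \<open>*\<^sub>C\<close> 75)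

class complex_algebra_1 = scaleC + real_algebra_1 +
  assumes scaleC_add_right: "c *\<^sub>C (x + y) = c *\<^sub>C x + c *\<^sub>C y"
    and scaleC_add_left: "(c + d) *\<^sub>C x = c *\<^sub>C x + d *\<^sub>C x"
    and scaleC_scaleC: "c *\<^sub>C d *\<^sub>C x = (c * d) *\<^sub>C x"
    and scaleC_of_real: "complex_of_real r *\<^sub>C x = r *\<^sub>R x"
    and mult_scaleC_left: "(c *\<^sub>C x) * y = c *\<^sub>C (x * y)"
    and mult_scaleC_right: "x * (c *\<^sub>C y) = c *\<^sub>C (x * y)"

class complex_banach_algebra_1 = complex_algebra_1 + real_normed_algebra_1 + banach +
  assumes norm_scaleC: "norm (c *\<^sub>C x) = cmod c * norm x"

text \<open>
  As in \<^class>\<open>real_normed_algebra_1\<close>, the unit is required to be different from zero, so the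
  zero algebra (in which the spectrum of the only element is empty) is excluded.
\<close>

class unital_cstar_algebra = complex_banach_algebra_1 +
  fixes star :: "'a \<Rightarrow> 'a"
  assumes star_star: "star (star x) = x"
    and star_add: "star (x + y) = star x + star y"
    and star_scaleC: "star (c *\<^sub>C x) = cnj c *\<^sub>C star x"
    and star_mult: "star (x * y) = star y * star x"
    and cstar_identity: "norm (star x * x) = (norm x)\<^sup>2"

text \<open>The axioms are satisfiable: the complex numbers are a model.\<close>

instantiation complex :: unital_cstar_algebra
begin

definition scaleC_complex :: "complex \<Rightarrow> complex \<Rightarrow> complex"
  where "scaleC_complex c x = c * x"

definition star_complex :: "complex \<Rightarrow> complex"
  where "star_complex x = cnj x"

instance
  by standard
    (simp_all add: scaleC_complex_def star_complex_def algebra_simps scaleR_conv_of_real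
      norm_mult power2_eq_square)

end

definition invertible_elem :: "'a::ring_1 \<Rightarrow> bool"
  where "invertible_elem a \<longleftrightarrow> (\<exists>b. a * b = 1 \<and> b * a = 1)"

text \<open>Two-sided inverse in a possibly noncommutative ring; meaningful for invertible elements only.\<close>

definition inverse_elem :: "'a::ring_1 \<Rightarrow> 'a"
  where "inverse_elem a = (THE b. a * b = 1 \<and> b * a = 1)"

definition spectrum :: "'a::complex_algebra_1 \<Rightarrow> complex set"
  where "spectrum a = {t. \<not> invertible_elem (a - t *\<^sub>C 1)}"

text \<open>
  For elements of a complex unital Banach algebra the spectrum is nonempty and compact, so the
  supremum below is a genuine one.
\<close>

definition spectral_seminorm :: "'a::complex_algebra_1 \<Rightarrow> real"
  where "spectral_seminorm a = (SUP t\<in>spectrum a. cmod t)"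

definition positive_elem :: "'a::unital_cstar_algebra \<Rightarrow> bool"
  where "positive_elem a \<longleftrightarrow>
    star a = a \<and> (\<forall>t\<in>spectrum a. \<exists>r\<ge>0. t = complex_of_real r)"

definition positive_definite_cone :: "'a::unital_cstar_algebra set"
  where "positive_definite_cone = {a. positive_elem a \<and> invertible_elem a}"

definition central_elem :: "'a::ring_1 \<Rightarrow> bool"
  where "central_elem a \<longleftrightarrow> (\<forall>x. a * x = x * a)"

end

theory Submission
  imports Defs "HOL-Computational_Algebra.Fundamental_Theorem_Algebra"
begin

text \<open>
  Each of (ii), (iii), (v) leads to \<open>\<parallel>bx\<parallel> = \<parallel>bx\<parallel>\<^sub>S\<close> for all \<open>x\<close> in the cone, with \<open>b = a\<^sup>2\<close>, and
  (iv) is this condition for \<open>b = a\<close>. Let \<open>w = bg\<close> with \<open>g\<close> self-adjoint; the spectrum of \<open>w\<close> is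
  real. For small \<open>\<epsilon> > 0\<close> the element \<open>1 - \<epsilon>w\<^sup>2\<close> is of the form \<open>bx\<close> and has its spectrum in
  \<open>[0, 1]\<close>, so its norm is at most 1 and hence \<open>Re w\<^sup>2 \<ge> 0\<close>. With \<open>w = k + im\<close> this reads
  \<open>m\<^sup>2 \<le> k\<^sup>2\<close>. Replacing \<open>g\<close> by \<open>g - sb\<^sup>-\<^sup>1\<close> turns \<open>k\<close> into \<open>k - s\<close> and preserves \<open>m\<close>, so
  \<open>m\<^sup>2 \<le> (k - s)\<^sup>2\<close> for every real \<open>s\<close>. Thus \<open>m\<close> vanishes on every approximate eigenspace of \<open>k\<close>,
  i.e. \<open>m = 0\<close>, and \<open>bg = (bg)\<^sup>* = gb\<close>. Centrality passes from \<open>a\<^sup>2\<close> to \<open>a\<close>, because the positive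
  invertible \<open>a\<close> anticommutes with no self-adjoint element except 0.

  The argument needs neither square roots nor the continuous functional calculus: finite sums of
  resolvents of \<open>k\<close> serve as a partition of unity.
\<close>

subsection \<open>Invertible elements\<close>

lemma invertible_elemI:
  fixes x :: "'a::ring_1"
  assumes "l * x = 1" "x * r = 1"
  shows "invertible_elem x"
proof -
  have "l = l * (x * r)" using assms(2) by simp
  also have "\<dots> = r" using assms(1) by (simp flip: mult.assoc)
  finally show ?thesis unfolding invertible_elem_def using assms by blast
qed

lemma inverse_elem_eq:
  fixes x :: "'a::ring_1"
  assumes "x * y = 1" "y * x = 1"
  shows "inverse_elem x = y"
  unfolding inverse_elem_def
proof (rule the_equality)
  fix b assume "x * b = 1 \<and> b * x = 1"
  then show "b = y"
    using assms by (metis mult.assoc mult_1_left mult_1_right)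
qed (use assms in simp)

lemma inverse_elem:
  fixes x :: "'a::ring_1"
  assumes "invertible_elem x"
  shows "x * inverse_elem x = 1" "inverse_elem x * x = 1"
  using assms inverse_elem_eq unfolding invertible_elem_def by metis+

lemma inverse_elem_cancel:
  fixes x :: "'a::ring_1"
  assumes "invertible_elem x"
  shows "x * (inverse_elem x * y) = y" "inverse_elem x * (x * y) = y"
  using inverse_elem[OF assms] by (simp_all flip: mult.assoc)

lemma invertible_inverse_elem:
  "invertible_elem (x::'a::ring_1) \<Longrightarrow> invertible_elem (inverse_elem x)"
  by (meson inverse_elem invertible_elemI)

lemma invertible_mult:
  fixes x y :: "'a::ring_1"
  assumes "invertible_elem x" "invertible_elem y"
  shows "invertible_elem (x * y)"
proof (rule invertible_elemI)
  show "(inverse_elem y * inverse_elem x) * (x * y) = 1"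
    by (simp add: assms inverse_elem inverse_elem_cancel mult.assoc)
  show "(x * y) * (inverse_elem y * inverse_elem x) = 1"
    by (simp add: assms inverse_elem inverse_elem_cancel mult.assoc)
qed

lemma invertible_uminus_iff [simp]: "invertible_elem (- x) \<longleftrightarrow> invertible_elem (x::'a::ring_1)"
  unfolding invertible_elem_def by (metis minus_minus mult_minus_left mult_minus_right)

lemma invertible_one [simp]: "invertible_elem (1::'a::ring_1)"
  unfolding invertible_elem_def by auto

lemma not_invertible_zero [simp]: "\<not> invertible_elem (0::'a::ring_1)"
  unfolding invertible_elem_def by auto

lemma invertible_mult_left_iff:
  fixes x y :: "'a::ring_1"
  assumes "invertible_elem x"
  shows "invertible_elem (x * y) \<longleftrightarrow> invertible_elem y"
  using invertible_mult[OF assms, of y]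
    invertible_mult[OF invertible_inverse_elem[OF assms], of "x * y"]
  by (auto simp: inverse_elem_cancel[OF assms])

lemma invertible_mult_right_iff:
  fixes x y :: "'a::ring_1"
  assumes "invertible_elem y"
  shows "invertible_elem (x * y) \<longleftrightarrow> invertible_elem x"
  using invertible_mult[OF _ assms, of x]
    invertible_mult[OF _ invertible_inverse_elem[OF assms], of "x * y"]
  by (auto simp: inverse_elem[OF assms] mult.assoc)

text \<open>Expanding the inverse of \<open>1 - y * x\<close> as a formal geometric series and
  regrouping suggests 1 + ycx, where c is the inverse of \<open>1 - x * y\<close>. The candidate is
  then verified algebraically.\<close>

lemma invertible_one_minus_swap:
  fixes x y :: "'a::ring_1"
  assumes "invertible_elem (1 - x * y)"
  shows "invertible_elem (1 - y * x)"
proof (rule invertible_elemI)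
  let ?c = "inverse_elem (1 - x * y)"
  have l: "?c - ?c * (x * y) = 1" and r: "?c - x * (y * ?c) = 1"
    using inverse_elem[OF assms] by (simp_all add: algebra_simps)
  have "(1 + y * ?c * x) * (1 - y * x) = 1 - y * x + y * ((?c - ?c * (x * y)) * x)"
    by (simp add: algebra_simps)
  then show "(1 + y * ?c * x) * (1 - y * x) = 1" by (simp add: l)
  have "(1 - y * x) * (1 + y * ?c * x) = 1 - y * x + y * ((?c - x * (y * ?c)) * x)"
    by (simp add: algebra_simps)
  then show "(1 - y * x) * (1 + y * ?c * x) = 1" by (simp add: r)
qed

lemma invertible_one_minus:
  fixes x :: "'a::{real_normed_algebra_1,banach}"
  assumes "norm x < 1"
  shows "invertible_elem (1 - x)"
proof -
  have s: "summable (\<lambda>n. x ^ n)"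
    using assms by (rule complete_algebra_summable_geometric)
  have e: "(\<Sum>n. x ^ n) = 1 + (\<Sum>n. x ^ Suc n)"
    using suminf_split_head[OF s] by simp
  have "(\<Sum>n. x ^ Suc n) = x * (\<Sum>n. x ^ n)"
    using suminf_mult[OF s, of x] by simp
  moreover have "(\<Sum>n. x ^ Suc n) = (\<Sum>n. x ^ n) * x"
    using suminf_mult2[OF s, of x] by (simp add: power_commutes)
  ultimately show ?thesis
    using e by (intro invertible_elemI[of "\<Sum>n. x ^ n" _ "\<Sum>n. x ^ n"])
      (simp_all add: algebra_simps)
qed

subsection \<open>Complex scalars and the spectrum\<close>

lemma scaleC_one [simp]: "1 *\<^sub>C (x::'a::complex_algebra_1) = x"
  using scaleC_of_real[of 1 x] by simp

lemma scaleC_zero_left [simp]: "0 *\<^sub>C (x::'a::complex_algebra_1) = 0"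
  using scaleC_of_real[of 0 x] by simp

lemma scaleC_zero_right [simp]: "c *\<^sub>C (0::'a::complex_algebra_1) = 0"
  using scaleC_add_right[of c 0 "0::'a"] by simp

lemma scaleC_minus_left [simp]: "(- c) *\<^sub>C (x::'a::complex_algebra_1) = - (c *\<^sub>C x)"
  using scaleC_add_left[of "- c" c x] by (simp add: eq_neg_iff_add_eq_0)

lemma scaleC_minus_right [simp]: "c *\<^sub>C (- x::'a::complex_algebra_1) = - (c *\<^sub>C x)"
  using scaleC_add_right[of c "- x" x] by (simp add: eq_neg_iff_add_eq_0)

lemma scaleC_diff_left: "(c - d) *\<^sub>C (x::'a::complex_algebra_1) = c *\<^sub>C x - d *\<^sub>C x"
  using scaleC_add_left[of c "- d" x] by simp

lemma scaleC_diff_right: "c *\<^sub>C (x - y::'a::complex_algebra_1) = c *\<^sub>C x - c *\<^sub>C y"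
  using scaleC_add_right[of c x "- y"] by simp

lemmas scaleC_simps = scaleC_add_left scaleC_add_right scaleC_diff_left scaleC_diff_right
  scaleC_scaleC mult_scaleC_left mult_scaleC_right

lemma invertible_scaleC_iff:
  fixes x :: "'a::complex_algebra_1"
  assumes "c \<noteq> 0"
  shows "invertible_elem (c *\<^sub>C x) \<longleftrightarrow> invertible_elem x"
proof -
  have "invertible_elem (c *\<^sub>C (1::'a))"
    by (rule invertible_elemI[of "(1 / c) *\<^sub>C 1" _ "(1 / c) *\<^sub>C 1"])
      (simp_all add: scaleC_simps assms)
  from invertible_mult_left_iff[OF this, of x] show ?thesis
    by (simp add: scaleC_simps)
qed

lemma invertible_scaleR_iff:
  fixes x :: "'a::complex_algebra_1"
  shows "r \<noteq> 0 \<Longrightarrow> invertible_elem (r *\<^sub>R x) \<longleftrightarrow> invertible_elem x"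
  using invertible_scaleC_iff[of "complex_of_real r" x] by (simp add: scaleC_of_real)

lemma invertible_scaleC_minus:
  fixes x :: "'a::complex_banach_algebra_1"
  assumes "norm x < cmod c"
  shows "invertible_elem (c *\<^sub>C 1 - x)"
proof -
  have c: "c \<noteq> 0" using assms norm_ge_zero[of x] by auto
  have "norm ((1 / c) *\<^sub>C x) < 1"
    using assms c by (simp add: norm_scaleC norm_divide field_simps)
  then have "invertible_elem (c *\<^sub>C (1 - (1 / c) *\<^sub>C x))"
    using invertible_one_minus invertible_scaleC_iff[OF c] by blast
  then show ?thesis using c by (simp add: scaleC_simps)
qed

lemma norm_ge_spectrum:
  fixes x :: "'a::complex_banach_algebra_1"
  assumes "t \<in> spectrum x"
  shows "cmod t \<le> norm x"
  using assms invertible_scaleC_minus[of x t] invertible_uminus_iff[of "x - t *\<^sub>C 1"]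
  by (force simp: spectrum_def)

lemma invertible_scaleR_minus:
  fixes x :: "'a::complex_banach_algebra_1"
  shows "norm x < r \<Longrightarrow> invertible_elem (r *\<^sub>R 1 - x)"
  using invertible_scaleC_minus[of x "complex_of_real r"] by (simp add: scaleC_of_real)

lemma spectrum_mult_swap:
  fixes x y :: "'a::complex_algebra_1"
  assumes "t \<noteq> 0" "invertible_elem (x * y - t *\<^sub>C 1)"
  shows "invertible_elem (y * x - t *\<^sub>C 1)"
proof -
  have *: "u - t *\<^sub>C 1 = (- t) *\<^sub>C (1 - (1 / t) *\<^sub>C u)" for u :: 'a
    using assms(1) by (simp add: scaleC_simps)
  have "invertible_elem (1 - ((1 / t) *\<^sub>C x) * y)"
    using assms unfolding *[of "x * y"]
    by (subst (asm) invertible_scaleC_iff) (auto simp: mult_scaleC_left)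
  then have "invertible_elem (1 - y * ((1 / t) *\<^sub>C x))"
    by (rule invertible_one_minus_swap)
  then show ?thesis
    using assms(1) unfolding *[of "y * x"]
    by (subst invertible_scaleC_iff) (auto simp: mult_scaleC_right)
qed

text \<open>Away from 0 the two spectra agree for arbitrary factors; invertibility of both factors
  settles the point 0.\<close>

lemma spectrum_mult_commute:
  fixes x y :: "'a::complex_algebra_1"
  assumes "invertible_elem x" "invertible_elem y"
  shows "spectrum (x * y) = spectrum (y * x)"
proof -
  have "invertible_elem (x * y)" "invertible_elem (y * x)"
    using assms invertible_mult by auto
  then have "invertible_elem (x * y - t *\<^sub>C 1) \<longleftrightarrow> invertible_elem (y * x - t *\<^sub>C 1)" for t
    using spectrum_mult_swap[of t x y] spectrum_mult_swap[of t y x] by (cases "t = 0") auto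
  then show ?thesis by (auto simp: spectrum_def)
qed

text \<open>
  This replaces the spectral radius formula. It is Rickart's averaging argument along the powers
  of two, driven by \<open>(1 - w\<^sup>2y\<^sup>2)\<^sup>-\<^sup>1 = ((1 - wy)\<^sup>-\<^sup>1 + (1 + wy)\<^sup>-\<^sup>1) / 2\<close>: averaging preserves the modulus of
  continuity of the resolvent, whereas inside the disc the resolvents of the powers tend to 1.
\<close>

lemma power_norm_less_one:
  fixes y :: "'a::complex_banach_algebra_1"
  assumes inv: "\<And>z. cmod z \<le> 1 \<Longrightarrow> invertible_elem (1 - z *\<^sub>C y)" and "norm y \<le> 1"
  shows "\<exists>n. norm (y ^ (2 ^ n)) < 1"
proof -
  define F where "F n z = inverse_elem (1 - z *\<^sub>C (y ^ (2 ^ n)))" for n z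
  have inv_n: "invertible_elem (1 - z *\<^sub>C (y ^ (2 ^ n)))" if "cmod z \<le> 1" for n z
    using that
  proof (induction n arbitrary: z)
    case 0
    then show ?case using inv by simp
  next
    case (Suc n)
    \<comment> \<open>The closed unit disc is stable under square roots, so the difference of
      squares yields two factors to which the induction hypothesis applies.\<close>
    let ?v = "csqrt z"
    have v: "cmod ?v \<le> 1"
      using Suc.prems by (simp add: norm_csqrt real_sqrt_le_1_iff)
    have "(1 - ?v *\<^sub>C (y ^ (2 ^ n))) * (1 - (- ?v) *\<^sub>C (y ^ (2 ^ n)))
        = 1 - (?v * ?v) *\<^sub>C (y ^ (2 ^ n) * y ^ (2 ^ n))"
      by (simp add: algebra_simps scaleC_simps)
    also have "y ^ (2 ^ n) * y ^ (2 ^ n) = y ^ (2 ^ Suc n)"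
      by (simp add: power_add mult_2)
    also have "?v * ?v = z"
      by (metis power2_csqrt power2_eq_square)
    finally show ?case
      using invertible_mult[OF Suc.IH[of ?v] Suc.IH[of "- ?v"]] v by simp
  qed
  have F_right: "(1 - z *\<^sub>C (y ^ (2 ^ n))) * F n z = 1"
    and F_left: "F n z * (1 - z *\<^sub>C (y ^ (2 ^ n))) = 1" if "cmod z \<le> 1" for n z
    unfolding F_def using inverse_elem inv_n[OF that] by blast+
  have F_double: "F (Suc n) (v * v) = (1/2) *\<^sub>R (F n v + F n (- v))" if "cmod v \<le> 1" for n v
  proof -
    let ?u = "v *\<^sub>C (y ^ (2 ^ n))"
    have pm: "(1 - ?u) * F n v = 1" "F n v * (1 - ?u) = 1"
      "(1 + ?u) * F n (- v) = 1" "F n (- v) * (1 + ?u) = 1"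
      using F_right[of v n] F_left[of v n] F_right[of "- v" n] F_left[of "- v" n] that by auto
    let ?W = "1 - (v * v) *\<^sub>C (y ^ (2 ^ Suc n))"
    have sq: "?W = (1 + ?u) * (1 - ?u)" "?W = (1 - ?u) * (1 + ?u)"
      by (simp_all add: algebra_simps scaleC_simps power_add mult_2)
    have "?W * F n v = 1 + ?u" "?W * F n (- v) = 1 - ?u"
      by (simp only: sq(1) mult.assoc pm mult_1_right, simp only: sq(2) mult.assoc pm mult_1_right)
    moreover have "F n v * ?W = 1 + ?u" "F n (- v) * ?W = 1 - ?u"
      by (simp only: sq(2) mult.assoc[symmetric] pm mult_1_left,
          simp only: sq(1) mult.assoc[symmetric] pm mult_1_left)
    ultimately have "?W * (F n v + F n (- v)) = 2" "(F n v + F n (- v)) * ?W = 2"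
      by (simp_all only: distrib_left distrib_right) simp_all
    moreover have "(1/2) *\<^sub>R (2::'a) = 1"
      using scaleR_half_double[of "1::'a"] by simp
    ultimately show ?thesis
      unfolding F_def[of "Suc n"] by (intro inverse_elem_eq) simp_all
  qed
  have cont: "continuous_on (cball 0 1) (F 0)"
  proof (rule continuous_onI)
    fix w :: complex and e :: real
    assume w: "w \<in> cball 0 1" and e: "0 < e"
    define B where "B = norm (F 0 w) + 1"
    have B: "0 < B" and FB: "norm (F 0 w) \<le> B"
      by (simp_all add: B_def add_nonneg_pos)
    \<comment> \<open>The first bound lets half of \<open>norm (F 0 z)\<close> be absorbed, giving
      \<open>norm (F 0 z) \<le> 2 * B\<close>; the second then makes the difference at most
      e/2.\<close>
    define d where "d = min (1 / (2 * B)) (e / (4 * B * B))"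
    have d: "0 < d" using B e by (simp add: d_def)
    show "\<exists>d>0. \<forall>z\<in>cball 0 1. dist z w < d \<longrightarrow> dist (F 0 z) (F 0 w) \<le> e"
    proof (intro exI[of _ d] conjI ballI impI d)
      fix z :: complex assume z: "z \<in> cball 0 1" and zd: "dist z w < d"
      have "F 0 z - F 0 w = F 0 z * (1 - w *\<^sub>C y) * F 0 w - F 0 z * (1 - z *\<^sub>C y) * F 0 w"
        using F_right[of w 0] F_left[of z 0] w z by (simp add: mult.assoc)
      also have "\<dots> = (z - w) *\<^sub>C (F 0 z * y * F 0 w)"
        by (simp add: algebra_simps scaleC_simps)
      finally have "norm (F 0 z - F 0 w) = cmod (z - w) * norm (F 0 z * y * F 0 w)"
        by (simp add: norm_scaleC)
      also have "norm (F 0 z * y * F 0 w) \<le> norm (F 0 z) * 1 * B"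
        by (intro norm_mult_ineq[THEN order_trans] mult_mono) (use assms(2) FB in auto)
      finally have *: "norm (F 0 z - F 0 w) \<le> cmod (z - w) * (norm (F 0 z) * B)"
        by (simp add: mult_left_mono)
      have zw: "cmod (z - w) \<le> 1 / (2 * B)" "cmod (z - w) \<le> e / (4 * B * B)"
        using zd by (auto simp: d_def dist_norm)
      have "norm (F 0 z) \<le> norm (F 0 z - F 0 w) + norm (F 0 w)"
        by (metis diff_add_cancel norm_triangle_ineq)
      also have "\<dots> \<le> 1 / (2 * B) * (norm (F 0 z) * B) + norm (F 0 w)"
        using * zw(1) B by (smt (verit) mult_right_mono mult_nonneg_nonneg norm_ge_zero)
      also have "1 / (2 * B) * (norm (F 0 z) * B) = norm (F 0 z) / 2"
        using B by (simp add: field_simps)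
      finally have "norm (F 0 z) \<le> 2 * B" using FB by simp
      then have "cmod (z - w) * (norm (F 0 z) * B) \<le> e / (4 * B * B) * (2 * B * B)"
        using zw(2) B e by (intro mult_mono) auto
      also have "\<dots> \<le> e" using B e by (simp add: field_simps)
      finally show "dist (F 0 z) (F 0 w) \<le> e" using * by (simp add: dist_norm)
    qed
  qed
  then have "uniformly_continuous_on (cball 0 1) (F 0)"
    by (rule compact_uniformly_continuous) simp
  then obtain d where d: "0 < d"
    and ud: "\<And>z w. z \<in> cball 0 1 \<Longrightarrow> w \<in> cball 0 1 \<Longrightarrow> dist w z < d \<Longrightarrow> dist (F 0 w) (F 0 z) < 1/4"
    unfolding uniformly_continuous_on_def by (metis zero_less_divide_1_iff zero_less_numeral)
  \<comment> \<open>On the unit circle w and tw have distance 1 - t < d, so uniform continuity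
    compares the resolvent at these two points.\<close>
  define t where "t = max 0 (1 - d / 2)"
  have t: "0 \<le> t" "t < 1" "1 - t < d" using d by (auto simp: t_def)
  have tp: "0 \<le> t ^ (2 ^ n)" "t ^ (2 ^ n) \<le> 1" for n
    using t by (auto simp: power_le_one)
  \<comment> \<open>Passing from n to n + 1 averages two differences of level n, so the bound 1/4
    persists while the radius \<open>t ^ (2 ^ n)\<close> is squared each time.\<close>
  have close: "norm (F n w - F n (complex_of_real (t ^ (2 ^ n)) * w)) \<le> 1/4" if "cmod w = 1" for n w
    using that
  proof (induction n arbitrary: w)
    case 0
    have "cmod (w - complex_of_real t * w) = 1 - t"
    proof -
      have "w - complex_of_real t * w = complex_of_real (1 - t) * w"
        by (simp add: algebra_simps)
      then have "cmod (w - complex_of_real t * w) = \<bar>1 - t\<bar> * cmod w"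
        by (metis norm_mult norm_of_real)
      then show ?thesis using 0 t by simp
    qed
    moreover have "cmod (complex_of_real t * w) \<le> 1"
      using 0 t by (simp add: norm_mult)
    ultimately show ?case
      using ud[of "complex_of_real t * w" w] 0 t by (simp add: dist_norm)
  next
    case (Suc n)
    let ?v = "csqrt w" and ?t = "complex_of_real (t ^ (2 ^ n))"
    have v: "cmod ?v = 1" using Suc.prems by (simp add: norm_csqrt)
    have vv: "?v * ?v = w" by (metis power2_csqrt power2_eq_square)
    have tv: "cmod (?t * ?v) \<le> 1"
      unfolding norm_mult norm_of_real abs_of_nonneg[OF tp(1)] v using tp(2) by simp
    have "complex_of_real (t ^ (2 ^ Suc n)) * w = (?t * ?v) * (?t * ?v)"
      using vv by (simp add: power_add mult_2 ac_simps)
    then have "F (Suc n) w - F (Suc n) (complex_of_real (t ^ (2 ^ Suc n)) * w)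
        = (1/2) *\<^sub>R ((F n ?v - F n (?t * ?v)) + (F n (- ?v) - F n (?t * (- ?v))))"
      using F_double[of ?v n] F_double[of "?t * ?v" n] v tv vv
      by (simp add: scaleR_diff_right scaleR_add_right)
    also have "norm \<dots> \<le> (1/2) * (1/4 + 1/4)"
      unfolding norm_scaleR
      by (intro mult_mono norm_triangle_mono Suc.IH) (use v in auto)
    finally show ?case by simp
  qed
  \<comment> \<open>Radius below 1/9 forces the resolvent there to within 1/8 of 1. With the 1/4
    from \<open>close\<close>, \<open>F n 1\<close> is within 3/8 of 1, and the power of y is then
    bounded by twice that, 3/4.\<close>
  have "(\<lambda>n. t ^ n) \<longlonglongrightarrow> 0" using t by (intro LIMSEQ_realpow_zero) auto
  then obtain m where m: "\<And>n. n \<ge> m \<Longrightarrow> norm (t ^ n) < 1/9"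
    using LIMSEQ_D[of "\<lambda>n. t ^ n" 0 "1/9"] by auto
  obtain n where n: "norm (t ^ (2 ^ n)) < 1/9"
    using m[of "2 ^ m"] less_exp[of m] by (metis less_imp_le)
  let ?Y = "y ^ (2 ^ n)" and ?t = "t ^ (2 ^ n)"
  have Y: "norm ?Y \<le> 1"
    using norm_power_ineq[of y "2 ^ n"] power_le_one[of "norm y" "2 ^ n"] assms(2) by simp
  let ?G = "F n (complex_of_real ?t)"
  have "?G - 1 = ?t *\<^sub>R (?Y * ?G)"
    using F_right[of "complex_of_real ?t" n] tp[of n]
    by (simp add: algebra_simps scaleC_of_real del: of_real_power)
  then have "norm (?G - 1) \<le> ?t * norm (?Y * ?G)"
    using tp[of n] by simp
  also have "\<dots> \<le> (1/9) * (1 * norm ?G)"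
    using n tp[of n] Y
    by (intro mult_mono norm_mult_ineq[THEN order_trans] mult_right_mono) auto
  finally have "norm (?G - 1) \<le> norm ?G / 9" by simp
  moreover have "norm ?G \<le> norm (?G - 1) + 1"
    using norm_triangle_ineq[of "?G - 1" 1] by simp
  ultimately have "norm (?G - 1) \<le> 1/8" by simp
  moreover have "norm (F n 1 - ?G) \<le> 1/4"
    using close[of 1 n] by simp
  moreover have "norm (F n 1 - 1) \<le> norm (F n 1 - ?G) + norm (?G - 1)"
    using norm_triangle_ineq[of "F n 1 - ?G" "?G - 1"] by simp
  ultimately have e: "norm (F n 1 - 1) \<le> 3/8" by simp
  have "?Y = (F n 1 - 1) - ?Y * (F n 1 - 1)"
    using F_right[of 1 n] by (simp add: algebra_simps)
  then have "norm ?Y \<le> norm (F n 1 - 1) + norm (?Y * (F n 1 - 1))"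
    using norm_triangle_ineq4[of "F n 1 - 1" "?Y * (F n 1 - 1)"] by simp
  also have "\<dots> \<le> 3/8 + 1 * (3/8)"
    by (intro add_mono e norm_mult_ineq[THEN order_trans] mult_mono) (use Y e in auto)
  finally show ?thesis by (intro exI[of _ n]) simp
qed

subsection \<open>Self-adjoint and positive elements\<close>

lemma star_zero [simp]: "star (0::'a::unital_cstar_algebra) = 0"
  using star_scaleC[of 0 "0::'a"] by simp

lemma star_minus [simp]: "star (- x) = - star (x::'a::unital_cstar_algebra)"
  using star_scaleC[of "-1" x] by simp

lemma star_diff: "star (x - y) = star x - star (y::'a::unital_cstar_algebra)"
  using star_add[of x "- y"] by simp

lemma star_scaleR [simp]: "star (r *\<^sub>R x) = r *\<^sub>R star (x::'a::unital_cstar_algebra)"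
  using star_scaleC[of "complex_of_real r" x] by (simp add: scaleC_of_real)

lemma star_one [simp]: "star (1::'a::unital_cstar_algebra) = 1"
  by (metis mult_1_right star_mult star_star)

lemma star_sum: "star (\<Sum>i\<in>I. f i) = (\<Sum>i\<in>I. star (f i::'a::unital_cstar_algebra))"
  by (induction I rule: infinite_finite_induct) (simp_all add: star_add)

lemma norm_star [simp]: "norm (star x) = norm (x::'a::unital_cstar_algebra)"
proof -
  have le: "norm y \<le> norm (star y)" for y :: 'a
  proof (cases "y = 0")
    case False
    have "norm y * norm y \<le> norm (star y) * norm y"
      using norm_mult_ineq[of "star y" y] by (simp add: cstar_identity power2_eq_square)
    then show ?thesis using False by simp
  qed simp
  show ?thesis using le[of x] le[of "star x"] by (simp add: star_star)
qed

lemma star_inverse_elem: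
  fixes x :: "'a::unital_cstar_algebra"
  assumes "invertible_elem x"
  shows "star (inverse_elem x) = inverse_elem (star x)"
  by (rule inverse_elem_eq[symmetric])
    (simp_all add: inverse_elem[OF assms] flip: star_mult)

lemma norm_selfadjoint_square:
  fixes h :: "'a::unital_cstar_algebra"
  shows "star h = h \<Longrightarrow> norm (h * h) = norm h * norm h"
  using cstar_identity[of h] by (simp add: power2_eq_square)

text \<open>Arens' trick: translate by an imaginary multiple is of the unit. A spectral point with
  imaginary part b would give (b + s)^2 <= norm(g)^2 + s^2 for all real s; the terms s^2 cancel, and
  what remains is linear in s and fails for a suitable s.\<close>

lemma selfadjoint_invertible_nonreal:
  fixes h :: "'a::unital_cstar_algebra"
  assumes h: "star h = h" and t: "Im t \<noteq> 0"
  shows "invertible_elem (h - t *\<^sub>C 1)"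
proof (rule ccontr)
  assume not_inv: "\<not> invertible_elem (h - t *\<^sub>C 1)"
  define g where "g = h - Re t *\<^sub>R 1"
  define b where "b = Im t"
  have g: "star g = g" by (simp add: g_def star_diff h)
  have bound: "b * b + 2 * b * s \<le> norm g * norm g" for s
  proof -
    define x where "x = g + (\<i> * complex_of_real s) *\<^sub>C 1"
    have "t *\<^sub>C (1::'a) = Re t *\<^sub>R 1 + (\<i> * complex_of_real b) *\<^sub>C 1"
      using arg_cong[OF complex_eq[of t], of "\<lambda>s. s *\<^sub>C (1::'a)"]
      by (simp add: scaleC_add_left scaleC_of_real b_def)
    then have "h - t *\<^sub>C 1 = x - (\<i> * complex_of_real (b + s)) *\<^sub>C 1"
      by (simp add: x_def g_def scaleC_simps algebra_simps)
    with not_inv have "(\<i> * complex_of_real (b + s)) \<in> spectrum x"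
      by (simp add: spectrum_def)
    then have "\<bar>b + s\<bar> \<le> norm x"
      using norm_ge_spectrum[of "\<i> * complex_of_real (b + s)" x]
      by (metis norm_of_real norm_mult norm_ii mult_1_left)
    then have "(b + s)\<^sup>2 \<le> (norm x)\<^sup>2"
      using power_mono[of "\<bar>b + s\<bar>" "norm x" 2] by simp
    also have "\<dots> = norm (star x * x)" by (simp add: cstar_identity)
    also have "star x * x = g * g + (s * s) *\<^sub>R 1"
      by (simp add: x_def star_add star_scaleC g algebra_simps scaleC_simps
          flip: scaleC_of_real)
    also have "norm \<dots> \<le> norm (g * g) + s * s"
      using norm_triangle_ineq[of "g * g" "(s * s) *\<^sub>R 1"] by simp
    also have "norm (g * g) = norm g * norm g" using g by (rule norm_selfadjoint_square)
    finally show ?thesis by (simp add: power2_eq_square algebra_simps)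
  qed
  have "b \<noteq> 0" using t by (simp add: b_def)
  then have "b * b + norm g * norm g \<le> norm g * norm g"
    using bound[of "norm g * norm g / (2 * b)"] by simp
  then show False using \<open>b \<noteq> 0\<close> by (auto simp: mult_le_0_iff)
qed

text \<open>By the C*-identity the powers \<open>y ^ (2 ^ n)\<close> of the normalised element keep
  norm 1. If neither sign of the norm were in the spectrum, \<open>1 - z *\<^sub>C y\<close> would
  be invertible on the whole closed disc (nonreal 1/z being harmless), contradicting
  \<open>power_norm_less_one\<close>.\<close>

lemma selfadjoint_norm_in_spectrum:
  fixes h :: "'a::unital_cstar_algebra"
  assumes h: "star h = h"
  shows "\<not> invertible_elem (h - norm h *\<^sub>R 1) \<or> \<not> invertible_elem (h + norm h *\<^sub>R 1)"
proof (cases "h = 0")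
  case False
  show ?thesis
  proof (rule ccontr)
    assume "\<not> ?thesis"
    then have pm: "invertible_elem (h - norm h *\<^sub>R 1)" "invertible_elem (h + norm h *\<^sub>R 1)"
      by auto
    define y where "y = (1 / norm h) *\<^sub>R h"
    have y: "star y = y" "norm y = 1" using False h by (simp_all add: y_def)
    have pow: "star (y ^ k) = y ^ k \<and> norm (y ^ (2 ^ n)) = 1" for k n
    proof
      have star_pow: "star (y ^ k) = y ^ k" for k
        by (induction k) (simp_all add: star_mult y power_commutes)
      then show "star (y ^ k) = y ^ k" .
      show "norm (y ^ (2 ^ n)) = 1"
      proof (induction n)
        case (Suc n)
        have "y ^ (2 ^ Suc n) = y ^ (2 ^ n) * y ^ (2 ^ n)"
          by (simp add: power_add mult_2)
        then show ?case
          using Suc.IH norm_selfadjoint_square[OF star_pow] by simp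
      qed (simp add: y)
    qed
    have "invertible_elem (1 - z *\<^sub>C y)" if z: "cmod z \<le> 1" for z
    proof (cases "cmod z < 1")
      case True
      then show ?thesis by (intro invertible_one_minus) (simp add: norm_scaleC y)
    next
      case False
      then have z1: "cmod z = 1" using z by simp
      then have z0: "z \<noteq> 0" by auto
      have eq: "1 - z *\<^sub>C y = (- z) *\<^sub>C (y - (1 / z) *\<^sub>C 1)"
        using z0 by (simp add: scaleC_simps)
      have "invertible_elem (y - (1 / z) *\<^sub>C 1)"
      proof (cases "Im (1 / z) = 0")
        case True
        then obtain s where s: "1 / z = complex_of_real s"
          by (metis complex_is_Real_iff Reals_cases)
        have "cmod (1 / z) = 1" using z1 by (simp add: norm_divide)
        then have "s = 1 \<or> s = - 1" unfolding s norm_of_real by linarith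
        then have "1 / z = 1 \<or> 1 / z = - 1" unfolding s by auto
        moreover have "norm h *\<^sub>R (y - 1) = h - norm h *\<^sub>R 1"
          "norm h *\<^sub>R (y + 1) = h + norm h *\<^sub>R 1"
          using \<open>h \<noteq> 0\<close> by (simp_all add: y_def scaleR_diff_right scaleR_add_right)
        ultimately show ?thesis
          using pm invertible_scaleR_iff[of "norm h" "y - 1"] invertible_scaleR_iff[of "norm h" "y + 1"]
            \<open>h \<noteq> 0\<close> by auto
      next
        case False
        then show ?thesis using selfadjoint_invertible_nonreal y(1) by blast
      qed
      then show ?thesis unfolding eq using z0 by (subst invertible_scaleC_iff) auto
    qed
    then obtain n where "norm (y ^ (2 ^ n)) < 1"
      using power_norm_less_one[of y] y(2) by auto
    then show False using pow by simp
  qed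
qed simp

lemma spectral_seminorm_selfadjoint:
  fixes h :: "'a::unital_cstar_algebra"
  assumes "star h = h"
  shows "spectral_seminorm h = norm h"
  unfolding spectral_seminorm_def
proof (rule cSup_eq_maximum)
  have "complex_of_real (norm h) \<in> spectrum h \<or> complex_of_real (- norm h) \<in> spectrum h"
    using selfadjoint_norm_in_spectrum[OF assms] unfolding spectrum_def mem_Collect_eq scaleC_of_real
    by simp
  then show "norm h \<in> cmod ` spectrum h"
    by (auto simp: image_iff intro: bexI[rotated])
  show "t \<le> norm h" if "t \<in> cmod ` spectrum h" for t
    using that norm_ge_spectrum by auto
qed

text \<open>Nonreal spectral points are excluded by self-adjointness, so only negative ones have to
  be ruled out. This form reduces positivity proofs to exhibiting inverses.\<close>

lemma positive_elem_iff:
  fixes h :: "'a::unital_cstar_algebra"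
  shows "positive_elem h \<longleftrightarrow> star h = h \<and> (\<forall>r>0. invertible_elem (h + r *\<^sub>R 1))"
proof (intro iffI conjI allI impI)
  assume h: "positive_elem h"
  then show "star h = h" by (simp add: positive_elem_def)
  fix r :: real assume r: "r > 0"
  show "invertible_elem (h + r *\<^sub>R 1)"
  proof (rule ccontr)
    assume "\<not> invertible_elem (h + r *\<^sub>R 1)"
    then have "complex_of_real (- r) \<in> spectrum h"
      unfolding spectrum_def mem_Collect_eq scaleC_of_real by simp
    then obtain s where "s \<ge> 0" "complex_of_real (- r) = complex_of_real s"
      using h unfolding positive_elem_def by blast
    then show False using r by (metis of_real_eq_iff neg_0_le_iff_le not_le)
  qed
next
  assume h: "star h = h \<and> (\<forall>r>0. invertible_elem (h + r *\<^sub>R 1))"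
  show "positive_elem h"
    unfolding positive_elem_def
  proof (intro conjI ballI)
    fix t assume t: "t \<in> spectrum h"
    then have "Im t = 0" using h selfadjoint_invertible_nonreal by (auto simp: spectrum_def)
    then have t': "t = complex_of_real (Re t)" by (simp add: complex_eq_iff)
    have "\<not> invertible_elem (h + (- Re t) *\<^sub>R 1)"
      using t unfolding spectrum_def mem_Collect_eq by (subst (asm) t') (simp add: scaleC_of_real)
    then have "\<not> - Re t > 0" using h by blast
    then show "\<exists>r\<ge>0. t = complex_of_real r" using t' by (intro exI[of _ "Re t"]) simp
  qed (use h in simp)
qed

section \<open>Norm criterion for positivity and the order structure\<close>

lemma positive_elem_selfadjoint: "positive_elem h \<Longrightarrow> star h = h"
  by (simp add: positive_elem_def)

text \<open>Together with its converse \<open>norm_le_if_positive_elem\<close> this turns positivity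
  into a norm inequality, whence sums of positive elements are positive by the triangle
  inequality.\<close>

lemma positive_elem_if_norm_le:
  fixes h :: "'a::unital_cstar_algebra"
  assumes "star h = h" "norm (c *\<^sub>R 1 - h) \<le> c"
  shows "positive_elem h"
  unfolding positive_elem_iff
proof (intro conjI allI impI assms(1))
  fix r :: real assume "r > 0"
  then have "invertible_elem ((c + r) *\<^sub>R 1 - (c *\<^sub>R 1 - h))"
    using assms(2) by (intro invertible_scaleR_minus) simp
  then show "invertible_elem (h + r *\<^sub>R 1)" by (simp add: scaleR_add_left add.commute)
qed

text \<open>If y = c - h had norm above c, positivity of h would exclude norm(y) from the spectrum
  of y, and norm(h) < c + norm(y) would exclude -norm(y).\<close>

lemma norm_le_if_positive_elem:
  fixes h :: "'a::unital_cstar_algebra"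
  assumes h: "positive_elem h" and c: "norm h \<le> c"
  shows "norm (c *\<^sub>R 1 - h) \<le> c"
proof (rule ccontr)
  let ?y = "c *\<^sub>R 1 - h"
  assume "\<not> norm ?y \<le> c"
  then have y: "norm ?y > c" by simp
  have "0 \<le> c" using c norm_ge_zero[of h] by linarith
  have eq: "- (h + (norm ?y - c) *\<^sub>R 1) = ?y - norm ?y *\<^sub>R 1"
    by (simp add: scaleR_diff_left)
  have "invertible_elem (- (h + (norm ?y - c) *\<^sub>R 1))"
    using h y unfolding positive_elem_iff invertible_uminus_iff by simp
  then have "invertible_elem (?y - norm ?y *\<^sub>R 1)"
    by (simp only: eq)
  moreover have "invertible_elem ((c + norm ?y) *\<^sub>R 1 - h)"
    using c y \<open>0 \<le> c\<close> by (intro invertible_scaleR_minus) linarith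
  then have "invertible_elem (?y + norm ?y *\<^sub>R 1)"
    by (simp add: scaleR_add_left algebra_simps)
  moreover have "star ?y = ?y" using h by (simp add: star_diff positive_elem_selfadjoint)
  ultimately show False using selfadjoint_norm_in_spectrum[of ?y] by simp
qed

lemma positive_elem_add:
  fixes x y :: "'a::unital_cstar_algebra"
  assumes x: "positive_elem x" and y: "positive_elem y"
  shows "positive_elem (x + y)"
proof (rule positive_elem_if_norm_le[of _ "norm x + norm y"])
  show "star (x + y) = x + y" using assms by (simp add: star_add positive_elem_selfadjoint)
  have "norm ((norm x *\<^sub>R 1 - x) + (norm y *\<^sub>R 1 - y)) \<le> norm x + norm y"
    using norm_le_if_positive_elem[OF x order_refl] norm_le_if_positive_elem[OF y order_refl]
    by (rule norm_triangle_mono)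
  then show "norm ((norm x + norm y) *\<^sub>R 1 - (x + y)) \<le> norm x + norm y"
    by (simp add: scaleR_add_left algebra_simps)
qed

lemma positive_elem_scaleR:
  fixes x :: "'a::unital_cstar_algebra"
  assumes x: "positive_elem x" and c: "c \<ge> 0"
  shows "positive_elem (c *\<^sub>R x)"
proof (rule positive_elem_if_norm_le[of _ "c * norm x"])
  have "(c * norm x) *\<^sub>R 1 - c *\<^sub>R x = c *\<^sub>R (norm x *\<^sub>R 1 - x)"
    by (simp add: scaleR_diff_right)
  then show "norm ((c * norm x) *\<^sub>R 1 - c *\<^sub>R x) \<le> c * norm x"
    using norm_le_if_positive_elem[OF x order_refl] c by (simp add: mult_left_mono)
qed (simp add: positive_elem_selfadjoint[OF x])

lemma positive_elem_of_real: "c \<ge> 0 \<Longrightarrow> positive_elem (c *\<^sub>R (1::'a::unital_cstar_algebra))"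
  by (rule positive_elem_if_norm_le[of _ c]) simp_all

text \<open>For r > 0, h^2 + r splits into the factors h - i sqrt(r) and h + i sqrt(r), both
  invertible.\<close>

lemma positive_elem_square:
  fixes h :: "'a::unital_cstar_algebra"
  assumes h: "star h = h"
  shows "positive_elem (h * h)"
  unfolding positive_elem_iff
proof (intro conjI allI impI)
  fix r :: real assume r: "r > 0"
  let ?t = "\<i> * complex_of_real (sqrt r)"
  have "(h - ?t *\<^sub>C 1) * (h - (- ?t) *\<^sub>C 1) = h * h - (?t * ?t) *\<^sub>C 1"
    by (simp add: algebra_simps scaleC_simps)
  also have "?t * ?t = complex_of_real (- r)"
    using r by (simp add: algebra_simps flip: of_real_mult)
  finally have "(h - ?t *\<^sub>C 1) * (h - (- ?t) *\<^sub>C 1) = h * h + r *\<^sub>R 1"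
    unfolding scaleC_of_real by simp
  then show "invertible_elem (h * h + r *\<^sub>R 1)"
    using invertible_mult[OF selfadjoint_invertible_nonreal selfadjoint_invertible_nonreal,
        OF h _ h, of ?t "- ?t"] r by simp
qed (simp add: star_mult h)

text \<open>In the operator order x <= x + y <= M with M the norm of the sum, so no point above M,
  in particular not norm(x), can lie in the spectrum of x.\<close>

lemma norm_le_norm_add_positive_elem:
  fixes x y :: "'a::unital_cstar_algebra"
  assumes x: "positive_elem x" and y: "positive_elem y"
  shows "norm x \<le> norm (x + y)"
proof (rule ccontr)
  let ?M = "norm (x + y)"
  assume "\<not> norm x \<le> ?M"
  then have M: "norm x > ?M" by simp
  have xy: "positive_elem (x + y)" using assms by (rule positive_elem_add)
  have "positive_elem (?M *\<^sub>R 1 - (x + y))"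
  proof (rule positive_elem_if_norm_le[of _ ?M])
    show "star (?M *\<^sub>R 1 - (x + y)) = ?M *\<^sub>R 1 - (x + y)"
      unfolding star_diff positive_elem_selfadjoint[OF xy] by simp
    show "norm (?M *\<^sub>R 1 - (?M *\<^sub>R 1 - (x + y))) \<le> ?M" by (simp add: add.commute)
  qed
  from positive_elem_add[OF this y] have "positive_elem (?M *\<^sub>R 1 - x)" by simp
  then have "invertible_elem (?M *\<^sub>R 1 - x + (norm x - ?M) *\<^sub>R 1)"
    using M by (simp add: positive_elem_iff)
  moreover have "?M *\<^sub>R 1 - x + (norm x - ?M) *\<^sub>R 1 = - (x - norm x *\<^sub>R 1)"
    by (simp add: scaleR_diff_left)
  ultimately have "invertible_elem (x - norm x *\<^sub>R 1)"
    by (metis invertible_uminus_iff)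
  moreover have "0 < norm x" using M norm_ge_zero[of "x + y"] by linarith
  then have "invertible_elem (x + norm x *\<^sub>R 1)"
    using x by (simp add: positive_elem_iff)
  ultimately show False
    using selfadjoint_norm_in_spectrum[OF positive_elem_selfadjoint[OF x]] by simp
qed

subsection \<open>The positive definite cone\<close>

lemma coneD:
  assumes "p \<in> positive_definite_cone"
  shows "positive_elem p" "star p = p" "invertible_elem p"
  using assms by (auto simp: positive_definite_cone_def positive_elem_def)

lemma coneI_lower_bound:
  fixes p :: "'a::unital_cstar_algebra"
  assumes "positive_elem (p - d *\<^sub>R 1)" "d > 0"
  shows "p \<in> positive_definite_cone"
proof -
  have "positive_elem (p - d *\<^sub>R 1 + d *\<^sub>R 1)"
    using assms positive_elem_of_real[of d] by (intro positive_elem_add) auto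
  moreover have "invertible_elem (p - d *\<^sub>R 1 + d *\<^sub>R 1)"
    using assms by (simp only: positive_elem_iff)
  ultimately show ?thesis by (simp add: positive_definite_cone_def)
qed

lemma cone_lower_bound:
  fixes p :: "'a::unital_cstar_algebra"
  assumes p: "p \<in> positive_definite_cone"
  obtains d where "d > 0" "positive_elem (p - d *\<^sub>R 1)"
proof -
  note inv = coneD(3)[OF p]
  let ?q = "inverse_elem p"
  \<comment> \<open>For 0 < r < 2d the element p - d + r is a perturbation of p within reach of the
    Neumann series; for r >= 2d the shift r - d is positive and positivity of p suffices.\<close>
  define d where "d = 1 / (2 * (norm ?q + 1))"
  have pos: "norm ?q + 1 > 0" by (smt (verit) norm_ge_zero)
  then have d: "d > 0" by (simp add: d_def)
  have "invertible_elem (p - d *\<^sub>R 1 + r *\<^sub>R 1)" if r: "r > 0" for r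
  proof (cases "r < 2 * d")
    case True
    have "2 * d = 1 / (norm ?q + 1)" using pos by (simp add: d_def field_simps)
    then have "\<bar>d - r\<bar> < 1 / (norm ?q + 1)" using True r d by (simp add: abs_less_iff)
    then have "\<bar>d - r\<bar> * (norm ?q + 1) < 1" using pos by (simp add: field_simps)
    moreover have "norm ((d - r) *\<^sub>R ?q) \<le> \<bar>d - r\<bar> * (norm ?q + 1)"
      by (simp add: distrib_left)
    ultimately have "norm ((d - r) *\<^sub>R ?q) < 1" by (rule le_less_trans[rotated])
    then have "invertible_elem (p * (1 - (d - r) *\<^sub>R ?q))"
      by (intro invertible_mult inv invertible_one_minus)
    moreover have "p * (1 - (d - r) *\<^sub>R ?q) = p - d *\<^sub>R 1 + r *\<^sub>R 1"
      by (simp add: algebra_simps inverse_elem[OF inv])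
    ultimately show ?thesis by simp
  next
    case False
    then have "invertible_elem (p + (r - d) *\<^sub>R 1)"
      using coneD(1)[OF p] d by (simp add: positive_elem_iff)
    moreover have "p + (r - d) *\<^sub>R 1 = p - d *\<^sub>R 1 + r *\<^sub>R 1"
      by (simp add: algebra_simps)
    ultimately show ?thesis by simp
  qed
  then have "positive_elem (p - d *\<^sub>R 1)"
    by (simp add: positive_elem_iff star_diff coneD(2)[OF p])
  with d show thesis by (rule that)
qed

lemma cone_add_positive:
  fixes p :: "'a::unital_cstar_algebra"
  assumes p: "p \<in> positive_definite_cone" and x: "positive_elem x"
  shows "p + x \<in> positive_definite_cone" "x + p \<in> positive_definite_cone"
proof -
  obtain d where d: "d > 0" "positive_elem (p - d *\<^sub>R 1)" using cone_lower_bound[OF p] .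
  have "positive_elem ((p - d *\<^sub>R 1) + x)" using d(2) x by (rule positive_elem_add)
  then have "positive_elem (p + x - d *\<^sub>R 1)" by (simp add: algebra_simps)
  then show "p + x \<in> positive_definite_cone" using d(1) by (rule coneI_lower_bound)
  then show "x + p \<in> positive_definite_cone" by (simp add: add.commute)
qed

lemma cone_scaleR:
  fixes p :: "'a::unital_cstar_algebra"
  assumes "p \<in> positive_definite_cone" "c > 0"
  shows "c *\<^sub>R p \<in> positive_definite_cone"
  using assms positive_elem_scaleR[of p c] invertible_scaleR_iff[of c p]
  by (simp add: positive_definite_cone_def)

lemma cone_of_real: "c > 0 \<Longrightarrow> c *\<^sub>R (1::'a::unital_cstar_algebra) \<in> positive_definite_cone"
  using positive_elem_of_real[of c] invertible_scaleR_iff[of c "1::'a"]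
  by (simp add: positive_definite_cone_def)

lemma cone_inverse:
  fixes p :: "'a::unital_cstar_algebra"
  assumes p: "p \<in> positive_definite_cone"
  shows "inverse_elem p \<in> positive_definite_cone"
proof -
  note inv = coneD(3)[OF p]
  have "invertible_elem (inverse_elem p + r *\<^sub>R 1)" if r: "r > 0" for r
  proof -
    have "invertible_elem (p + (1 / r) *\<^sub>R 1)"
      using coneD(1)[OF p] r by (simp add: positive_elem_iff)
    then have "invertible_elem (r *\<^sub>R (inverse_elem p * (p + (1 / r) *\<^sub>R 1)))"
      using r inv by (subst invertible_scaleR_iff) (auto intro: invertible_mult invertible_inverse_elem)
    moreover have "r *\<^sub>R (inverse_elem p * (p + (1 / r) *\<^sub>R 1)) = inverse_elem p + r *\<^sub>R 1"
      using r by (simp add: distrib_left inverse_elem[OF inv] scaleR_add_right)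
    ultimately show ?thesis by simp
  qed
  then show ?thesis
    using inv by (simp add: positive_definite_cone_def positive_elem_iff star_inverse_elem
        coneD(2)[OF p] invertible_inverse_elem)
qed

text \<open>Without a square root of p: \<open>r *\<^sub>R inverse_elem p + y * y\<close> lies in
  the cone, and multiplying it by p gives (py)y + r. Swapping the factors py and y makes ypy + r
  invertible.\<close>

lemma positive_elem_conj:
  fixes p y :: "'a::unital_cstar_algebra"
  assumes p: "p \<in> positive_definite_cone" and y: "star y = y"
  shows "positive_elem (y * p * y)"
  unfolding positive_elem_iff
proof (intro conjI allI impI)
  note inv = coneD(3)[OF p]
  fix r :: real assume r: "r > 0"
  have "r *\<^sub>R inverse_elem p + y * y \<in> positive_definite_cone"
    using r by (intro cone_add_positive cone_scaleR cone_inverse p positive_elem_square y)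
  then have "invertible_elem (p * (r *\<^sub>R inverse_elem p + y * y))"
    using inv coneD(3) by (intro invertible_mult)
  also have "p * (r *\<^sub>R inverse_elem p + y * y) = (p * y) * y - complex_of_real (- r) *\<^sub>C 1"
    unfolding scaleC_of_real by (simp add: distrib_left inverse_elem[OF inv] mult.assoc add.commute)
  finally have "invertible_elem (y * (p * y) - complex_of_real (- r) *\<^sub>C 1)"
    by (rule spectrum_mult_swap[rotated]) (use r in simp)
  then show "invertible_elem (y * p * y + r *\<^sub>R 1)"
    unfolding scaleC_of_real by (simp add: mult.assoc)
qed (simp add: star_mult coneD(2)[OF p] y mult.assoc)

lemma cone_conj:
  fixes p y :: "'a::unital_cstar_algebra"
  assumes "p \<in> positive_definite_cone" "star y = y" "invertible_elem y"
  shows "y * p * y \<in> positive_definite_cone"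
  using assms positive_elem_conj by (simp add: positive_definite_cone_def invertible_mult)

text \<open>With q the inverse of p and t = ib, both (c + tp)q(c - tp) and (c - tp)q(c + tp) equal
  b^2 p + cqc, which lies in the cone. This yields a right and a left inverse.\<close>

lemma invertible_selfadjoint_add_imaginary:
  fixes p c :: "'a::unital_cstar_algebra"
  assumes p: "p \<in> positive_definite_cone" and c: "star c = c" and b: "b \<noteq> 0"
  shows "invertible_elem (c + (\<i> * complex_of_real b) *\<^sub>C p)"
proof -
  note inv = coneD(3)[OF p]
  let ?q = "inverse_elem p" and ?t = "\<i> * complex_of_real b"
  have tt: "?t * ?t = complex_of_real (- (b * b))" by (simp add: complex_eq_iff)
  have "(b * b) *\<^sub>R p + c * ?q * c \<in> positive_definite_cone" (is "?z \<in> _")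
    using b by (intro cone_add_positive cone_scaleR p positive_elem_conj cone_inverse c)
      (auto simp: zero_less_mult_iff)
  then have z: "invertible_elem ?z" by (rule coneD(3))
  have *: "(c + s *\<^sub>C p) * ?q * (c - s *\<^sub>C p) = c * ?q * c - (s * s) *\<^sub>C p" for s
    by (simp add: distrib_left distrib_right left_diff_distrib right_diff_distrib scaleC_simps
        mult.assoc inverse_elem[OF inv] inverse_elem_cancel[OF inv])
  have "(c + ?t *\<^sub>C p) * (?q * (c - ?t *\<^sub>C p)) = ?z"
    using *[of ?t] unfolding tt scaleC_of_real by (simp add: mult.assoc)
  moreover have "((c - ?t *\<^sub>C p) * ?q) * (c + ?t *\<^sub>C p) = ?z"
    using *[of "- ?t"] unfolding minus_mult_minus tt scaleC_of_real by (simp add: mult.assoc)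
  ultimately show ?thesis
    by (intro invertible_elemI[of "inverse_elem ?z * ((c - ?t *\<^sub>C p) * ?q)" _
          "(?q * (c - ?t *\<^sub>C p)) * inverse_elem ?z"])
      (simp only: mult.assoc[of "inverse_elem ?z"] inverse_elem[OF z],
        simp only: mult.assoc[of _ _ "inverse_elem ?z", symmetric] inverse_elem[OF z])
qed

subsection \<open>Rational functions of a self-adjoint element\<close>

definition poly_elem :: "complex poly \<Rightarrow> 'a::complex_algebra_1 \<Rightarrow> 'a"
  where "poly_elem p k = fold_coeffs (\<lambda>c y. c *\<^sub>C 1 + k * y) p 0"

lemma poly_elem_0 [simp]: "poly_elem 0 k = 0"
  by (simp add: poly_elem_def)

lemma poly_elem_pCons [simp]: "poly_elem (pCons c p) k = c *\<^sub>C 1 + k * poly_elem p k"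
  by (cases "c = 0 \<and> p = 0") (auto simp: poly_elem_def)

lemma poly_elem_1 [simp]: "poly_elem 1 k = 1"
  by (simp add: one_pCons)

lemma poly_elem_add: "poly_elem (p + q) k = poly_elem p k + poly_elem q k"
  by (induction p q rule: poly_induct2) (simp_all add: algebra_simps scaleC_simps)

lemma poly_elem_smult: "poly_elem (smult c p) k = c *\<^sub>C poly_elem p k"
  by (induction p) (simp_all add: algebra_simps scaleC_simps)

lemma poly_elem_diff: "poly_elem (p - q) k = poly_elem p k - poly_elem q k"
  using poly_elem_add[of p "smult (- 1) q" k] poly_elem_smult[of "- 1" q k] by simp

lemma poly_elem_mult: "poly_elem (p * q) k = poly_elem p k * poly_elem q k"
  by (induction p) (simp_all add: poly_elem_add poly_elem_smult algebra_simps scaleC_simps)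

text \<open>Roots are split off one by one over the complex numbers. A root z outside the spectrum
  contributes an invertible factor, so noninvertibility passes to the quotient. The zero polynomial
  is where a nonempty spectrum enters.\<close>

lemma poly_elem_not_invertible_root:
  fixes k :: "'a::complex_algebra_1"
  assumes "\<not> invertible_elem (poly_elem p k)" and "spectrum k \<noteq> {}"
  shows "\<exists>t\<in>spectrum k. poly p t = 0"
  using assms(1)
proof (induction "degree p" arbitrary: p rule: less_induct)
  case less
  show ?case
  proof (cases "degree p = 0")
    case True
    then obtain c where p: "p = [:c:]" by (metis degree_eq_zeroE)
    have "c = 0"
      using less.prems invertible_scaleC_iff[of c "1::'a"] p by auto
    then show ?thesis using assms(2) p by auto
  next
    case False
    then obtain z where "poly p z = 0"
      using fundamental_theorem_of_algebra[of p] by (auto simp: constant_degree)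
    then obtain q where p: "p = [:- z, 1:] * q"
      by (metis poly_eq_0_iff_dvd dvdE)
    have "q \<noteq> 0" using False p by auto
    then have deg: "degree q < degree p"
      unfolding p by (subst degree_mult_eq) auto
    have eval: "poly_elem p k = (k - z *\<^sub>C 1) * poly_elem q k"
      unfolding p poly_elem_mult by simp
    show ?thesis
    proof (cases "z \<in> spectrum k")
      case True
      then show ?thesis using \<open>poly p z = 0\<close> by auto
    next
      case False
      then have "\<not> invertible_elem (poly_elem q k)"
        using less.prems eval by (auto simp: spectrum_def intro: invertible_mult)
      from less.hyps[OF deg this] show ?thesis by (auto simp: p)
    qed
  qed
qed

text \<open>Encodes \<open>x = f(k)\<close> for \<open>f = P/Q\<close> rational; only the values of \<open>f\<close> on the spectrum of \<open>k\<close> matter.\<close>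

definition rational_calculus ::
    "'a::complex_algebra_1 \<Rightarrow> (complex \<Rightarrow> complex) \<Rightarrow> 'a \<Rightarrow> bool"
  where "rational_calculus k f x \<longleftrightarrow>
    (\<exists>P Q. invertible_elem (poly_elem Q k) \<and> x * poly_elem Q k = poly_elem P k \<and>
      (\<forall>t\<in>spectrum k. poly Q t \<noteq> 0 \<and> poly P t = f t * poly Q t))"

lemma rational_calculus_zero: "rational_calculus k (\<lambda>_. 0) 0"
  unfolding rational_calculus_def by (rule exI[of _ 0], rule exI[of _ 1]) simp

lemma rational_calculus_add:
  assumes "rational_calculus k f x" "rational_calculus k g y"
  shows "rational_calculus k (\<lambda>t. f t + g t) (x + y)"
proof -
  from assms obtain P Q R S where
    PQ: "invertible_elem (poly_elem Q k)" "x * poly_elem Q k = poly_elem P k"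
      "\<And>t. t \<in> spectrum k \<Longrightarrow> poly Q t \<noteq> 0 \<and> poly P t = f t * poly Q t" and
    RS: "invertible_elem (poly_elem S k)" "y * poly_elem S k = poly_elem R k"
      "\<And>t. t \<in> spectrum k \<Longrightarrow> poly S t \<noteq> 0 \<and> poly R t = g t * poly S t"
    unfolding rational_calculus_def by metis
  have "(x + y) * poly_elem (Q * S) k = poly_elem (P * S + R * Q) k"
  proof -
    have "poly_elem Q k * poly_elem S k = poly_elem S k * poly_elem Q k"
      by (simp only: mult.commute[of Q S] flip: poly_elem_mult)
    then have "y * (poly_elem Q k * poly_elem S k) = poly_elem R k * poly_elem Q k"
      by (simp only: mult.assoc[symmetric] RS(2))
    then show ?thesis
      by (simp add: poly_elem_add poly_elem_mult distrib_right mult.assoc flip: PQ(2))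
  qed
  moreover have "invertible_elem (poly_elem (Q * S) k)"
    unfolding poly_elem_mult using PQ(1) RS(1) by (rule invertible_mult)
  ultimately show ?thesis
    unfolding rational_calculus_def using PQ(3) RS(3)
    by (intro exI[of _ "P * S + R * Q"] exI[of _ "Q * S"]) (simp add: algebra_simps)
qed

lemma rational_calculus_sum:
  assumes "\<And>i. i \<in> I \<Longrightarrow> rational_calculus k (f i) (x i)"
  shows "rational_calculus k (\<lambda>t. \<Sum>i\<in>I. f i t) (\<Sum>i\<in>I. x i)"
  using assms
  by (induction I rule: infinite_finite_induct)
    (simp_all add: rational_calculus_zero rational_calculus_add)

text \<open>Up to the invertible factor Q(k), x - s is (P - sQ)(k); a root of P - sQ in the spectrum
  of k is a point where f takes the value s.\<close>

lemma spectrum_rational_calculus: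
  fixes k :: "'a::complex_algebra_1"
  assumes "rational_calculus k f x" "spectrum k \<noteq> {}" "s \<in> spectrum x"
  shows "\<exists>t\<in>spectrum k. f t = s"
proof -
  obtain P Q where PQ: "invertible_elem (poly_elem Q k)" "x * poly_elem Q k = poly_elem P k"
    "\<And>t. t \<in> spectrum k \<Longrightarrow> poly Q t \<noteq> 0 \<and> poly P t = f t * poly Q t"
    using assms(1) unfolding rational_calculus_def by metis
  have "poly_elem (P - smult s Q) k = (x - s *\<^sub>C 1) * poly_elem Q k"
    by (simp add: poly_elem_diff poly_elem_smult algebra_simps scaleC_simps PQ(2))
  then have "\<not> invertible_elem (poly_elem (P - smult s Q) k)"
    using assms(3) by (simp add: invertible_mult_right_iff[OF PQ(1)] spectrum_def)
  from poly_elem_not_invertible_root[OF this assms(2)] PQ(3)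
  show ?thesis by auto
qed

lemma selfadjoint_spectrum:
  fixes k :: "'a::unital_cstar_algebra"
  assumes k: "star k = k"
  shows "spectrum k \<noteq> {}" "t \<in> spectrum k \<Longrightarrow> Im t = 0 \<and> \<bar>Re t\<bar> \<le> norm k"
proof -
  have "complex_of_real (norm k) \<in> spectrum k \<or> complex_of_real (- norm k) \<in> spectrum k"
    using selfadjoint_norm_in_spectrum[OF k] unfolding spectrum_def mem_Collect_eq scaleC_of_real
    by simp
  then show "spectrum k \<noteq> {}" by auto
  assume t: "t \<in> spectrum k"
  then show "Im t = 0 \<and> \<bar>Re t\<bar> \<le> norm k"
    using selfadjoint_invertible_nonreal[OF k, of t] norm_ge_spectrum[OF t] abs_Re_le_cmod[of t]
    by (auto simp: spectrum_def)
qed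

text \<open>
  A discrete stand-in for the functional calculus: up to the factor \<open>e\<^sup>2\<close> the resolvent squares
  at distance \<open>e\<close> from the points of a grid of mesh \<open>e\<close> sum up to more than one quarter.
\<close>

lemma sum_resolvent_squares_lower_bound:
  fixes k :: "'a::unital_cstar_algebra" and n :: nat
  assumes k: "star k = k" and e: "e > 0"
    and grid: "\<And>t. \<bar>t\<bar> \<le> norm k \<Longrightarrow> \<exists>j<n. \<bar>t - s j\<bar> \<le> e"
  shows "(\<Sum>j<n. inverse_elem ((k - s j *\<^sub>R 1) * (k - s j *\<^sub>R 1) + (e * e) *\<^sub>R 1))
    - (1 / (4 * (e * e))) *\<^sub>R 1 \<in> positive_definite_cone"
proof -
  define P where "P j = (k - s j *\<^sub>R 1) * (k - s j *\<^sub>R 1) + (e * e) *\<^sub>R 1" for j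
  define q where "q = (\<Sum>j<n. inverse_elem (P j))"
  have P: "P j \<in> positive_definite_cone" for j
    unfolding P_def using e
    by (intro cone_add_positive positive_elem_square cone_of_real) (auto simp: star_diff k)
  define f where "f j t = 1 / ((t - of_real (s j)) * (t - of_real (s j)) + of_real (e * e))"
    for j and t :: complex
  have "rational_calculus k (f j) (inverse_elem (P j))" for j
  proof -
    let ?l = "[:- complex_of_real (s j), 1:]"
    let ?Q = "?l * ?l + [:complex_of_real (e * e):]"
    have l: "poly_elem ?l k = k - s j *\<^sub>R 1"
      unfolding poly_elem_pCons scaleC_minus_left scaleC_of_real by simp
    have Q: "poly_elem ?Q k = P j"
      unfolding poly_elem_add poly_elem_mult l P_def by (simp add: scaleC_of_real del: of_real_mult)
    have "poly ?Q t \<noteq> 0 \<and> 1 = f j t * poly ?Q t" if "t \<in> spectrum k" for t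
    proof -
      have t: "t = of_real (Re t)"
        using selfadjoint_spectrum(2)[OF k that] by (simp add: complex_eq_iff)
      have "(Re t - s j) * (Re t - s j) + e * e > 0"
        using e by (intro add_nonneg_pos) auto
      moreover have "poly ?Q t = of_real ((Re t - s j) * (Re t - s j) + e * e)"
        by (subst t) (simp add: algebra_simps)
      ultimately have "poly ?Q t \<noteq> 0" by (metis less_irrefl of_real_eq_0_iff)
      then show ?thesis by (simp add: f_def algebra_simps)
    qed
    then show ?thesis
      unfolding rational_calculus_def
    proof (intro exI conjI ballI)
      show "invertible_elem (poly_elem ?Q k)" unfolding Q by (rule coneD(3)[OF P])
      show "inverse_elem (P j) * poly_elem ?Q k = poly_elem 1 k"
        unfolding Q using inverse_elem[OF coneD(3)[OF P]] by simp
    qed auto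
  qed
  then have q_calc: "rational_calculus k (\<lambda>t. \<Sum>j<n. f j t) q"
    unfolding q_def by (intro rational_calculus_sum) auto
  have q_star: "star q = q"
    unfolding q_def star_sum by (intro sum.cong refl coneD(2) cone_inverse P)
  \<comment> \<open>A spectral point has a grid point within e, whose summand alone is at least
    1/(e^2 + e^2).\<close>
  let ?c = "1 / (2 * (e * e))"
  have "positive_elem (q - ?c *\<^sub>R 1)"
    unfolding positive_elem_iff
  proof (intro conjI allI impI)
    fix r :: real assume r: "r > 0"
    show "invertible_elem (q - ?c *\<^sub>R 1 + r *\<^sub>R 1)"
    proof (rule ccontr)
      assume "\<not> invertible_elem (q - ?c *\<^sub>R 1 + r *\<^sub>R 1)"
      moreover have "q - ?c *\<^sub>R 1 + r *\<^sub>R 1 = q - complex_of_real (?c - r) *\<^sub>C 1"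
        unfolding scaleC_of_real by (simp add: scaleR_diff_left)
      ultimately have "complex_of_real (?c - r) \<in> spectrum q" by (simp add: spectrum_def)
      then obtain t where t: "t \<in> spectrum k" "(\<Sum>j<n. f j t) = complex_of_real (?c - r)"
        using spectrum_rational_calculus[OF q_calc selfadjoint_spectrum(1)[OF k]] by blast
      define u where "u = Re t"
      have u: "t = of_real u" "\<bar>u\<bar> \<le> norm k"
        using selfadjoint_spectrum(2)[OF k t(1)] by (simp_all add: complex_eq_iff u_def)
      define g where "g j = 1 / ((u - s j) * (u - s j) + e * e)" for j
      have "f j t = of_real (g j)" for j by (simp add: f_def g_def u(1))
      then have "complex_of_real (\<Sum>j<n. g j) = complex_of_real (?c - r)" using t(2) by simp
      then have sum_g: "(\<Sum>j<n. g j) = ?c - r" by (simp only: of_real_eq_iff)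
      have g0: "g j \<ge> 0" for j unfolding g_def by (intro divide_nonneg_nonneg add_nonneg_nonneg) auto
      obtain j where j: "j < n" "\<bar>u - s j\<bar> \<le> e" using grid[OF u(2)] by blast
      have "(u - s j) * (u - s j) \<le> e * e"
        using mult_mono[OF j(2) j(2)] e by (simp add: abs_mult_self_eq)
      moreover have "(u - s j) * (u - s j) + e * e > 0" using e by (intro add_nonneg_pos) auto
      ultimately have "?c \<le> g j" unfolding g_def by (intro frac_le) auto
      also have "g j \<le> (\<Sum>j<n. g j)" using j(1) g0 by (intro member_le_sum) auto
      finally show False using sum_g r by simp
    qed
  qed (simp add: star_diff q_star)
  \<comment> \<open>Giving away half of the bound leaves a strictly positive margin, hence
    membership in the cone.\<close>
  moreover have "q - ?c *\<^sub>R 1 = (q - (1 / (4 * (e * e))) *\<^sub>R 1) - (1 / (4 * (e * e))) *\<^sub>R 1"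
    using e by (simp add: field_simps flip: scaleR_add_left)
  ultimately have "positive_elem ((q - (1 / (4 * (e * e))) *\<^sub>R 1) - (1 / (4 * (e * e))) *\<^sub>R 1)"
    by simp
  then have "q - (1 / (4 * (e * e))) *\<^sub>R 1 \<in> positive_definite_cone"
    by (rule coneI_lower_bound) (use e in simp)
  then show ?thesis by (simp add: q_def P_def)
qed

text \<open>For z the conjugated inverse, norm(z) > 1 would put norm(z) P - m^2 in the cone.
  Multiplying by the inverse of P and swapping factors removes norm(z) from the spectrum of z, while
  positivity of z already excludes -norm(z).\<close>

lemma norm_resolvent_conj_le_one:
  fixes m P :: "'a::unital_cstar_algebra"
  assumes P: "P \<in> positive_definite_cone" and m: "star m = m"
    and dom: "positive_elem (P - m * m)"
  shows "norm (m * inverse_elem P * m) \<le> 1"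
proof (rule ccontr)
  note inv = coneD(3)[OF P]
  let ?z = "m * inverse_elem P * m"
  assume "\<not> norm ?z \<le> 1"
  then have z: "norm ?z > 1" by simp
  have pos: "positive_elem ?z" using cone_inverse[OF P] m by (rule positive_elem_conj)
  have "(norm ?z - 1) *\<^sub>R P + (P - m * m) \<in> positive_definite_cone"
    using z P dom by (intro cone_add_positive cone_scaleR) auto
  then have "invertible_elem (- (((norm ?z - 1) *\<^sub>R P + (P - m * m)) * inverse_elem P))"
    unfolding invertible_uminus_iff
    by (intro invertible_mult invertible_inverse_elem inv coneD(3))
  also have "- (((norm ?z - 1) *\<^sub>R P + (P - m * m)) * inverse_elem P)
      = m * (m * inverse_elem P) - complex_of_real (norm ?z) *\<^sub>C 1"
    unfolding scaleC_of_real
    by (simp add: algebra_simps inverse_elem[OF inv] mult.assoc)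
  finally have "invertible_elem ((m * inverse_elem P) * m - complex_of_real (norm ?z) *\<^sub>C 1)"
    by (rule spectrum_mult_swap[rotated]) (use z in auto)
  then have "invertible_elem (?z - norm ?z *\<^sub>R 1)" by (simp add: scaleC_of_real)
  moreover have "invertible_elem (?z + norm ?z *\<^sub>R 1)"
    using pos z unfolding positive_elem_iff by (metis less_trans zero_less_one)
  ultimately show False
    using selfadjoint_norm_in_spectrum[OF positive_elem_selfadjoint[OF pos]] by blast
qed

text \<open>
  Heuristically, \<open>m\<close> has norm at most \<open>e\<close> on every spectral subspace of \<open>k\<close> belonging to an
  interval of radius \<open>e\<close>, and \<open>O(1/e)\<close> such intervals cover the spectrum. Since the squares of
  these norms add up, \<open>\<parallel>m\<parallel>\<^sup>2 = O(e)\<close>.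
\<close>

lemma eq_zero_if_square_le_shifted_squares:
  fixes k m :: "'a::unital_cstar_algebra"
  assumes k: "star k = k" and m: "star m = m"
    and dom: "\<And>s::real. positive_elem ((k - s *\<^sub>R 1) * (k - s *\<^sub>R 1) - m * m)"
  shows "m = 0"
proof (rule ccontr)
  assume "m \<noteq> 0"
  \<comment> \<open>The extra 1 makes t + K < 2K strict, so that the index found by rounding down
    stays below n.\<close>
  define K where "K = norm k + 1"
  have K: "K > 0" by (simp add: K_def add_nonneg_pos)
  have bound: "norm m * norm m * real n \<le> 16 * (K * K)" if n: "n > 0" for n
  proof -
    define e where "e = 2 * K / real n"
    have e: "e > 0" using K n by (simp add: e_def)
    define s where "s j = - K + real j * e" for j
    define P where "P j = (k - s j *\<^sub>R 1) * (k - s j *\<^sub>R 1) + (e * e) *\<^sub>R 1" for j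
    have P: "P j \<in> positive_definite_cone" for j
      unfolding P_def using e
      by (intro cone_add_positive positive_elem_square cone_of_real) (auto simp: star_diff k)
    have grid: "\<exists>j<n. \<bar>t - s j\<bar> \<le> e" if t: "\<bar>t\<bar> \<le> norm k" for t
    proof -
      define j where "j = nat \<lfloor>(t + K) / e\<rfloor>"
      have "t + K > 0" "t + K < 2 * K" using t by (auto simp: K_def abs_le_iff)
      then have "0 \<le> (t + K) / e" "(t + K) / e < real n"
        using e n by (simp_all add: pos_divide_less_eq) (simp add: e_def)
      then have "real j \<le> (t + K) / e" "(t + K) / e < real j + 1" "real j < real n"
        unfolding j_def by linarith+
      then have "j < n" "real j * e \<le> t + K" "t + K < real j * e + e"
        using e by (auto simp: field_simps)
      then show ?thesis by (intro exI[of _ j]) (auto simp: s_def abs_le_iff)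
    qed
    let ?c = "1 / (4 * (e * e))"
    define q where "q = (\<Sum>j<n. inverse_elem (P j))"
    have q: "q - ?c *\<^sub>R 1 \<in> positive_definite_cone"
      unfolding q_def P_def using k e grid by (rule sum_resolvent_squares_lower_bound)
    have "m * q * m = (\<Sum>j<n. m * inverse_elem (P j) * m)"
      by (simp add: q_def sum_distrib_left sum_distrib_right)
    also have "norm \<dots> \<le> (\<Sum>j<n. 1)"
    proof (rule sum_norm_le)
      fix j
      have "positive_elem (((k - s j *\<^sub>R 1) * (k - s j *\<^sub>R 1) - m * m) + (e * e) *\<^sub>R 1)"
        using dom e by (intro positive_elem_add positive_elem_of_real) auto
      then have "positive_elem (P j - m * m)" by (simp add: P_def algebra_simps)
      then show "norm (m * inverse_elem (P j) * m) \<le> 1"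
        by (rule norm_resolvent_conj_le_one[OF P m])
    qed
    finally have n1: "norm (m * q * m) \<le> real n" by simp
    \<comment> \<open>Since q dominates the scalar c, mqm dominates c m^2. With c = 1/(4e^2) and e =
      2K/n this bounds norm(m)^2 by 16 K^2 / n.\<close>
    have n2: "norm (?c *\<^sub>R (m * m)) \<le> norm (?c *\<^sub>R (m * m) + m * (q - ?c *\<^sub>R 1) * m)"
      using e by (intro norm_le_norm_add_positive_elem positive_elem_scaleR positive_elem_square m
          positive_elem_conj q) auto
    have n3: "?c *\<^sub>R (m * m) + m * (q - ?c *\<^sub>R 1) * m = m * q * m"
      by (simp add: algebra_simps)
    have n4: "norm (?c *\<^sub>R (m * m)) = ?c * (norm m * norm m)"
      unfolding norm_scaleR norm_selfadjoint_square[OF m] using e by simp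
    have "?c * (norm m * norm m) \<le> real n"
      using n2[unfolded n3 n4] n1 by (rule order_trans)
    then have "norm m * norm m \<le> real n * (4 * (e * e))" using e by (simp add: field_simps)
    also have "\<dots> = 16 * (K * K) / real n" using n by (simp add: e_def field_simps)
    finally show ?thesis using n by (simp add: field_simps)
  qed
  have "norm m * norm m > 0" using \<open>m \<noteq> 0\<close> by simp
  then obtain n where n: "16 * (K * K) < real n * (norm m * norm m)"
    using reals_Archimedean3 by blast
  then have "n > 0" using K by (cases n) (auto simp: mult_less_0_iff)
  with bound[of n] n show False by (simp add: mult.commute)
qed

subsection \<open>Central elements of the cone\<close>

lemma selfadjoint_decomposition:
  fixes x :: "'a::unital_cstar_algebra"
  obtains g h where "star g = g" "star h = h" "x = g + \<i> *\<^sub>C h" "star x = g - \<i> *\<^sub>C h"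
proof (rule that)
  let ?g = "(1/2) *\<^sub>C (x + star x)" and ?h = "(- \<i> / 2) *\<^sub>C (x - star x)"
  have half: "(1/2) *\<^sub>C y + (1/2) *\<^sub>C y = y" for y :: 'a
    by (simp flip: scaleC_add_left)
  show "star ?g = ?g" by (simp add: star_scaleC star_add star_star add.commute)
  show "star ?h = ?h" by (simp add: star_scaleC star_diff star_star scaleC_simps)
  show "x = ?g + \<i> *\<^sub>C ?h" "star x = ?g - \<i> *\<^sub>C ?h"
    using half[of x] half[of "star x"] by (simp_all add: scaleC_simps algebra_simps)
qed

lemma central_elem_if_commutes_selfadjoint:
  fixes a :: "'a::unital_cstar_algebra"
  assumes "\<And>g. star g = g \<Longrightarrow> a * g = g * a"
  shows "central_elem a"
  unfolding central_elem_def
proof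
  fix x :: 'a
  obtain g h where "star g = g" "star h = h" "x = g + \<i> *\<^sub>C h"
    by (rule selfadjoint_decomposition)
  then show "a * x = x * a"
    using assms[of g] assms[of h] by (simp add: algebra_simps scaleC_simps)
qed

text \<open>The self-adjoint e = i(ag - ga) anticommutes with a, so (ae)e = -eae. Swapping factors
  shows that eae and -eae have the same nonzero spectrum; as eae is positive, it vanishes. Then a
  e^2 = 0 and e = 0.\<close>

lemma central_elem_if_square_central:
  fixes a :: "'a::unital_cstar_algebra"
  assumes a: "a \<in> positive_definite_cone" and central: "central_elem (a * a)"
  shows "central_elem a"
proof (rule central_elem_if_commutes_selfadjoint)
  fix g :: 'a assume g: "star g = g"
  define e where "e = \<i> *\<^sub>C (a * g - g * a)"
  have e: "star e = e"
    by (simp add: e_def star_scaleC star_diff star_mult g coneD(2)[OF a] algebra_simps scaleC_simps)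
  have "a * a * g = g * (a * a)" using central by (simp add: central_elem_def)
  then have anti: "a * e = - (e * a)"
    by (simp add: e_def algebra_simps scaleC_simps)
  let ?z = "e * a * e"
  have pos: "positive_elem ?z" using a e by (rule positive_elem_conj)
  have z: "(a * e) * e = - ?z" by (simp add: anti)
  have "?z = 0"
  proof (rule ccontr)
    assume "?z \<noteq> 0"
    then have n: "norm ?z > 0" by simp
    then have inv: "invertible_elem (?z + norm ?z *\<^sub>R 1)"
      using pos unfolding positive_elem_iff by blast
    then have "invertible_elem (- (?z + norm ?z *\<^sub>R 1))" by (simp only: invertible_uminus_iff)
    then have "invertible_elem ((a * e) * e - complex_of_real (norm ?z) *\<^sub>C 1)"
      unfolding z scaleC_of_real by simp
    then have "invertible_elem (e * (a * e) - complex_of_real (norm ?z) *\<^sub>C 1)"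
      by (rule spectrum_mult_swap[rotated]) (use n in simp)
    then have "invertible_elem (?z - norm ?z *\<^sub>R 1)"
      by (simp add: scaleC_of_real mult.assoc)
    with inv show False
      using selfadjoint_norm_in_spectrum[OF positive_elem_selfadjoint[OF pos]] by blast
  qed
  then have "a * (e * e) = 0" using z by (simp add: mult.assoc)
  then have "e * e = 0"
    using inverse_elem_cancel(2)[OF coneD(3)[OF a], of "e * e"] by simp
  then have "e = 0" using norm_selfadjoint_square[OF e] by simp
  then have "(- \<i>) *\<^sub>C e = 0" by simp
  then have "a * g - g * a = 0" unfolding e_def scaleC_scaleC by simp
  then show "a * g = g * a" by simp
qed

text \<open>
  On an empty spectrum the spectral seminorm would be a constant junk value, which cannot agree with
  the norm of \<open>ax\<close> and of \<open>a(2x)\<close> alike. So the spectrum is nonempty without Gelfand--Mazur.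
\<close>

lemma spectrum_nonempty_if_norm_eq_spectral_seminorm:
  fixes a :: "'a::unital_cstar_algebra"
  assumes a: "a \<in> positive_definite_cone" and x: "x \<in> positive_definite_cone"
    and hyp: "\<And>x. x \<in> positive_definite_cone \<Longrightarrow> norm (a * x) = spectral_seminorm (a * x)"
  shows "spectrum (a * x) \<noteq> {}"
proof
  assume empty: "spectrum (a * x) = {}"
  have "invertible_elem (a * (2 *\<^sub>R x) - t *\<^sub>C 1)" for t
  proof -
    have "a * (2 *\<^sub>R x) - t *\<^sub>C 1 = complex_of_real 2 *\<^sub>C (a * x - (t / 2) *\<^sub>C 1)"
      unfolding scaleC_diff_right scaleC_scaleC by (simp only: scaleC_of_real) simp
    then show ?thesis
      using empty invertible_scaleC_iff[of "complex_of_real 2" "a * x - (t / 2) *\<^sub>C 1"]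
      by (auto simp: spectrum_def)
  qed
  then have "spectrum (a * (2 *\<^sub>R x)) = {}" by (simp add: spectrum_def)
  then have "norm (a * (2 *\<^sub>R x)) = norm (a * x)"
    using hyp[OF x] hyp[OF cone_scaleR[OF x, of 2]] empty by (simp add: spectral_seminorm_def)
  then have "a * x = 0" by simp
  then show False using invertible_mult[OF coneD(3)[OF a] coneD(3)[OF x]] by simp
qed

text \<open>Factor out a: ag - t = a(g - t q) with q the inverse of a. The real part of t is
  absorbed into the self-adjoint term, the imaginary part is a nonzero imaginary multiple of q in
  the cone.\<close>

lemma invertible_mult_selfadjoint_nonreal:
  fixes a g :: "'a::unital_cstar_algebra"
  assumes a: "a \<in> positive_definite_cone" and g: "star g = g" and t: "Im t \<noteq> 0"
  shows "invertible_elem (a * g - t *\<^sub>C 1)"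
proof -
  note inv = coneD(3)[OF a]
  let ?q = "inverse_elem a"
  have q: "?q \<in> positive_definite_cone" using a by (rule cone_inverse)
  have "star (g - Re t *\<^sub>R ?q) = g - Re t *\<^sub>R ?q"
    by (simp add: star_diff g coneD(2)[OF q])
  from invertible_selfadjoint_add_imaginary[OF q this, of "- Im t"] t
  have "invertible_elem (a * (g - Re t *\<^sub>R ?q + (\<i> * complex_of_real (- Im t)) *\<^sub>C ?q))"
    using inv invertible_mult by auto
  moreover have "a * (g - Re t *\<^sub>R ?q + (\<i> * complex_of_real (- Im t)) *\<^sub>C ?q)
      = a * g - (Re t *\<^sub>R 1 + (\<i> * complex_of_real (Im t)) *\<^sub>C 1)"
    by (simp add: distrib_left right_diff_distrib mult_scaleC_right inverse_elem[OF inv])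
  moreover have "Re t *\<^sub>R 1 + (\<i> * complex_of_real (Im t)) *\<^sub>C 1 = t *\<^sub>C (1::'a)"
    using arg_cong[OF complex_eq[of t], of "\<lambda>s. s *\<^sub>C (1::'a)"]
    by (simp add: scaleC_add_left scaleC_of_real)
  ultimately show ?thesis by simp
qed

lemma spectrum_square_mult_selfadjoint:
  fixes a g :: "'a::unital_cstar_algebra"
  assumes a: "a \<in> positive_definite_cone" and g: "star g = g"
    and t: "t \<in> spectrum ((a * g) * (a * g))"
  shows "\<exists>r\<ge>0. t = complex_of_real r"
proof -
  let ?w = "a * g"
  obtain s where ss: "s * s = t" by (metis power2_csqrt power2_eq_square)
  have "(?w - s *\<^sub>C 1) * (?w - (- s) *\<^sub>C 1) = ?w * ?w - (s * s) *\<^sub>C 1"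
    by (simp add: algebra_simps scaleC_simps)
  then have "\<not> invertible_elem ((?w - s *\<^sub>C 1) * (?w - (- s) *\<^sub>C 1))"
    using t ss by (simp add: spectrum_def)
  then have "Im s = 0"
    using invertible_mult invertible_mult_selfadjoint_nonreal[OF a g, of s]
      invertible_mult_selfadjoint_nonreal[OF a g, of "- s"] by force
  then have "t = complex_of_real (Re s * Re s)"
    unfolding ss[symmetric] by (simp add: complex_eq_iff)
  then show ?thesis by (intro exI[of _ "Re s * Re s"]) auto
qed

text \<open>With w = ag, the choice x = \<open>inverse_elem a\<close> - e gag gives ax = 1 - e w^2.
  Its spectrum lies in [0, 1], so the hypothesis bounds its norm by 1. Averaging with the adjoint
  and dividing by e puts Re w^2 within 1/e of the scalar 1/e, hence it is positive.\<close>

lemma positive_real_part_square: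
  fixes a g :: "'a::unital_cstar_algebra"
  assumes a: "a \<in> positive_definite_cone" and g: "star g = g"
    and hyp: "\<And>x. x \<in> positive_definite_cone \<Longrightarrow> norm (a * x) = spectral_seminorm (a * x)"
  shows "positive_elem ((1/2) *\<^sub>R ((a * g) * (a * g) + star (a * g) * star (a * g)))"
proof -
  note inv = coneD(3)[OF a]
  define w where "w = a * g"
  let ?q = "inverse_elem a" and ?b = "g * a * g"
  obtain d where d: "d > 0" "positive_elem (?q - d *\<^sub>R 1)"
    using cone_lower_bound[OF cone_inverse[OF a]] .
  \<comment> \<open>The first bound keeps x above d/2 and so in the cone; the second keeps the
    spectrum of 1 - e w^2 nonnegative.\<close>
  define e where "e = min (d / 2 / (norm ?b + 1)) (1 / (norm (w * w) + 1))"
  have b1: "norm ?b + 1 > 0" "norm (w * w) + 1 > 0"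
    by (simp_all add: add_nonneg_pos)
  have e: "e > 0" using d(1) b1 by (simp add: e_def)
  have "e * (norm ?b + 1) \<le> d / 2"
    unfolding pos_le_divide_eq[OF b1(1), symmetric] by (simp add: e_def)
  then have eb: "e * norm ?b \<le> d / 2" using e by (simp add: distrib_left)
  have "e * (norm (w * w) + 1) \<le> 1"
    unfolding pos_le_divide_eq[OF b1(2), symmetric] by (simp add: e_def)
  then have ew: "e * norm (w * w) \<le> 1" using e by (simp add: distrib_left)
  define x where "x = ?q - e *\<^sub>R ?b"
  have "positive_elem ((d / 2) *\<^sub>R 1 - e *\<^sub>R ?b)"
  proof (rule positive_elem_if_norm_le[of _ "d / 2"])
    show "star ((d / 2) *\<^sub>R 1 - e *\<^sub>R ?b) = (d / 2) *\<^sub>R 1 - e *\<^sub>R ?b"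
      by (simp add: star_diff star_mult g coneD(2)[OF a] mult.assoc)
    show "norm ((d / 2) *\<^sub>R 1 - ((d / 2) *\<^sub>R 1 - e *\<^sub>R ?b)) \<le> d / 2"
      using eb e by simp
  qed
  moreover have half: "d *\<^sub>R (1::'a) = (d / 2) *\<^sub>R 1 + (d / 2) *\<^sub>R 1"
    by (simp flip: scaleR_add_left)
  ultimately have "positive_elem (x - (d / 2) *\<^sub>R 1)"
    using positive_elem_add[OF d(2), of "(d / 2) *\<^sub>R 1 - e *\<^sub>R ?b"]
    by (simp add: x_def half diff_diff_eq add.commute)
  then have x: "x \<in> positive_definite_cone"
    by (rule coneI_lower_bound) (use d(1) in simp)
  have ax: "a * x = 1 - e *\<^sub>R (w * w)"
    by (simp add: x_def w_def right_diff_distrib inverse_elem[OF inv] mult.assoc)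
  have "spectral_seminorm (a * x) \<le> 1"
    unfolding spectral_seminorm_def
  proof (rule cSUP_least)
    show "spectrum (a * x) \<noteq> {}"
      using a x hyp by (rule spectrum_nonempty_if_norm_eq_spectral_seminorm)
    fix t assume t: "t \<in> spectrum (a * x)"
    have "a * x - t *\<^sub>C 1 = complex_of_real (- e) *\<^sub>C (w * w - ((1 - t) / e) *\<^sub>C 1)"
      unfolding ax scaleC_diff_right scaleC_scaleC
      by (subst scaleC_of_real) (use e in \<open>simp add: scaleC_diff_left\<close>)
    then have s: "(1 - t) / e \<in> spectrum (w * w)"
      using t e invertible_scaleC_iff[of "complex_of_real (- e)" "w * w - ((1 - t) / e) *\<^sub>C 1"]
      by (simp add: spectrum_def)
    then obtain r where r: "r \<ge> 0" "(1 - t) / e = complex_of_real r"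
      using spectrum_square_mult_selfadjoint[OF a g] by (auto simp: w_def)
    have "r \<le> norm (w * w)" using norm_ge_spectrum[OF s] r by simp
    then have "e * r \<le> 1" using ew e by (meson mult_left_mono order_trans less_imp_le)
    have "t = complex_of_real (1 - e * r)" using r(2) e by (simp add: field_simps)
    then have "cmod t = \<bar>1 - e * r\<bar>" by (simp only: norm_of_real)
    then show "cmod t \<le> 1" using \<open>e * r \<le> 1\<close> r(1) e by simp
  qed
  then have n: "norm (1 - e *\<^sub>R (w * w)) \<le> 1"
    using hyp[OF x] by (simp add: ax)
  then have n': "norm (1 - e *\<^sub>R (star w * star w)) \<le> 1"
    using norm_star[of "1 - e *\<^sub>R (w * w)"] by (simp add: star_diff star_mult)
  show ?thesis
    unfolding w_def[symmetric]
  proof (rule positive_elem_if_norm_le[of _ "1 / e"])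
    show "star ((1/2) *\<^sub>R (w * w + star w * star w)) = (1/2) *\<^sub>R (w * w + star w * star w)"
      by (simp add: star_add star_mult star_star add.commute)
    define S where "S = (1 - e *\<^sub>R (w * w)) + (1 - e *\<^sub>R (star w * star w))"
    have "(1 / (2 * e)) *\<^sub>R S = ((1 / (2 * e)) *\<^sub>R 1 + (1 / (2 * e)) *\<^sub>R 1)
        - (1/2) *\<^sub>R (w * w + star w * star w)"
      unfolding S_def scaleR_add_right scaleR_diff_right scaleR_scaleR using e by simp
    moreover have "1 / (2 * e) + 1 / (2 * e) = 1 / e" using e by (simp add: field_simps)
    ultimately have "(1 / (2 * e)) *\<^sub>R S = (1 / e) *\<^sub>R 1 - (1/2) *\<^sub>R (w * w + star w * star w)"
      by (simp only: scaleR_add_left[symmetric])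
    moreover have "norm S \<le> 1 + 1" unfolding S_def using n n' by (rule norm_triangle_mono)
    then have "norm ((1 / (2 * e)) *\<^sub>R S) \<le> 1 / e" using e by (simp add: field_simps)
    ultimately show "norm ((1 / e) *\<^sub>R 1 - (1/2) *\<^sub>R (w * w + star w * star w)) \<le> 1 / e"
      by (simp only:)
  qed
qed

lemma central_elem_if_norm_eq_spectral_seminorm:
  fixes a :: "'a::unital_cstar_algebra"
  assumes a: "a \<in> positive_definite_cone"
    and hyp: "\<And>x. x \<in> positive_definite_cone \<Longrightarrow> norm (a * x) = spectral_seminorm (a * x)"
  shows "central_elem a"
proof (rule central_elem_if_commutes_selfadjoint)
  fix g :: 'a assume g: "star g = g"
  let ?q = "inverse_elem a"
  obtain k m where k: "star k = k" and m: "star m = m"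
    and w: "a * g = k + \<i> *\<^sub>C m" and w': "star (a * g) = k - \<i> *\<^sub>C m"
    by (rule selfadjoint_decomposition)
  \<comment> \<open>The mixed terms uv and vu cancel between the square and the square of the
    adjoint.\<close>
  have square_sum: "(u + \<i> *\<^sub>C v) * (u + \<i> *\<^sub>C v) + (u - \<i> *\<^sub>C v) * (u - \<i> *\<^sub>C v)
      = (u * u - v * v) + (u * u - v * v)" for u v :: 'a
    by (simp add: algebra_simps scaleC_simps)
  have "m = 0"
  proof (rule eq_zero_if_square_le_shifted_squares[OF k m])
    fix s :: real
    let ?g = "g - s *\<^sub>R ?q" and ?k = "k - s *\<^sub>R 1"
    have g': "star ?g = ?g" using g coneD(2)[OF cone_inverse[OF a]] by (simp add: star_diff)
    have ag: "a * ?g = ?k + \<i> *\<^sub>C m"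
      using w inverse_elem[OF coneD(3)[OF a]] by (simp add: right_diff_distrib)
    then have ag': "star (a * ?g) = ?k - \<i> *\<^sub>C m"
      by (simp add: star_add star_diff star_scaleC k m)
    have "(a * ?g) * (a * ?g) + star (a * ?g) * star (a * ?g)
        = (?k * ?k - m * m) + (?k * ?k - m * m)"
      unfolding ag' unfolding ag by (rule square_sum)
    with positive_real_part_square[OF a g' hyp]
    show "positive_elem (?k * ?k - m * m)" by (simp add: scaleR_half_double)
  qed
  then have "star (a * g) = a * g" using w w' by simp
  then show "a * g = g * a" using g coneD(2)[OF a] by (simp add: star_mult)
qed

section \<open>The equivalences\<close>

lemma norm_eq_spectral_seminorm_if_central:
  fixes a :: "'a::unital_cstar_algebra"
  assumes "star a = a" "star x = x" "central_elem a"
  shows "norm (a * x) = spectral_seminorm (a * x)"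
proof -
  have "star (a * x) = a * x" using assms by (simp add: star_mult central_elem_def)
  then show ?thesis by (rule spectral_seminorm_selfadjoint[symmetric])
qed

theorem proposition4p4:
  fixes a :: "'a::unital_cstar_algebra"
  assumes "a \<in> positive_definite_cone"
  shows
    "(central_elem a \<longleftrightarrow>
        (\<forall>x\<in>positive_definite_cone. norm (a * x * inverse_elem a) = norm x)) \<and>
     (central_elem a \<longleftrightarrow>
        (\<forall>x\<in>positive_definite_cone. norm (a\<^sup>2 * x) = norm (a * x * a))) \<and>
     (central_elem a \<longleftrightarrow>
        (\<forall>x\<in>positive_definite_cone. norm (a * x) = spectral_seminorm (a * x))) \<and>
     (central_elem a \<longleftrightarrow>
        (\<forall>x\<in>positive_definite_cone. norm (a\<^sup>2 * x) = spectral_seminorm (a\<^sup>2 * x)))"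
    (is "(?i \<longleftrightarrow> ?ii) \<and> (?i \<longleftrightarrow> ?iii) \<and> (?i \<longleftrightarrow> ?iv) \<and> (?i \<longleftrightarrow> ?v)")
proof -
  note inv = coneD(3)[OF assms] and sa = coneD(2)[OF assms]
  have sq: "a\<^sup>2 = a * a" by (rule power2_eq_square)
  have sq_cone: "a * a \<in> positive_definite_cone"
    using positive_elem_square[OF sa] invertible_mult[OF inv inv]
    by (simp add: positive_definite_cone_def)
  \<comment> \<open>The implications run in the cycle (i), (ii), (iii), (v), (i), with (iv) tied to
    (i) separately.\<close>
  have "?i \<longrightarrow> ?ii"
  proof (intro impI ballI)
    fix x assume ?i
    then have "a * x * inverse_elem a = x * (a * inverse_elem a)"
      by (simp add: central_elem_def mult.assoc)
    then show "norm (a * x * inverse_elem a) = norm x" by (simp add: inverse_elem[OF inv])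
  qed
  moreover have "?ii \<longrightarrow> ?iii"
  proof (intro impI ballI)
    fix x :: 'a assume ii: ?ii and x: "x \<in> positive_definite_cone"
    \<comment> \<open>Condition (ii) is applied to axa, because conjugating it by a gives a^2
      x.\<close>
    have "a * x * a \<in> positive_definite_cone" using x sa inv by (rule cone_conj)
    with ii have "norm (a * (a * x * a) * inverse_elem a) = norm (a * x * a)" by blast
    then show "norm (a\<^sup>2 * x) = norm (a * x * a)"
      by (simp add: sq mult.assoc inverse_elem[OF inv])
  qed
  moreover have "?iii \<longrightarrow> ?v"
  proof (intro impI ballI)
    fix x :: 'a assume iii: ?iii and x: "x \<in> positive_definite_cone"
    \<comment> \<open>Moving one factor a to the other side keeps the spectrum and turns a^2 x into
      the self-adjoint axa, whose spectral seminorm is its norm.\<close>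
    have "spectrum (a * (a * x)) = spectrum ((a * x) * a)"
      using inv coneD(3)[OF x] by (intro spectrum_mult_commute invertible_mult)
    then have "spectral_seminorm (a\<^sup>2 * x) = spectral_seminorm (a * x * a)"
      by (simp add: spectral_seminorm_def sq mult.assoc)
    also have "\<dots> = norm (a * x * a)"
      using cone_conj[OF x sa inv] by (intro spectral_seminorm_selfadjoint coneD(2))
    finally show "norm (a\<^sup>2 * x) = spectral_seminorm (a\<^sup>2 * x)" using iii x by simp
  qed
  moreover have "?v \<longrightarrow> ?i"
    using central_elem_if_norm_eq_spectral_seminorm[OF sq_cone]
      central_elem_if_square_central[OF assms] by (simp add: sq)
  moreover have "?iv \<longrightarrow> ?i"
    using central_elem_if_norm_eq_spectral_seminorm[OF assms] by blast
  moreover have "?i \<longrightarrow> ?iv"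
    using norm_eq_spectral_seminorm_if_central[OF sa coneD(2)] by blast
  moreover have "?i \<longrightarrow> ?iii"
    unfolding central_elem_def sq by (metis mult.assoc)
  ultimately show ?thesis by blast
qed

end
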